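(* Let $U\subset\mathbb{R}^n$ be a definable connected subspace that is closed in $\mathbb{R}^n$ and of dimension $1$ (that is, it can be triangulated, by the definable triangulation theorem, by a complex of dimension $1$). Let $f:U\to U$ be a homeomorphism such that $\varLambda_{\mathrm{comb}}(f,U)\geq 1$. Then $f$ must have a fixed point.
   Context: Fix an o-minimal structure on $\mathbb{R}$ containing all semilinear sets; "definable" refers to this structure. Simplicial complexes are finite (geometric, in some $\mathbb{R}^n$) and are identified with their underlying compact polyhedra; non-compact definable sets are triangulated by unions of open simplices of finite complexes. $U^\infty$ denotes the Alexandroff (one-point) compactification of $U$. A definable compactification $X$ of a definable space $U$ is a compactification such that $X$ and the inclusion of $U$ in $X$ are definable. Combinatorial Lefschetz number. Let $Z$ be a simplicial complex (or a compact definable set), $D\subset Z$ definable and $l:Z\to Z$ a continuous map. By the definable triangulation theorem there are a simplicial complex $K$ and a definable homeomorphism $\tau:K\to Z$ such that $A=\tau^{-1}(D)$ is a union of open simplices (interiors of simplices) of $K$; put $\varphi=\tau^{-1}\circ l\circ\tau$. Let $\varphi^{\mathrm{simp}}:K'\to K$ be a simplicial approximation of $\varphi$, where $K'$ is a subdivision of $K$, and let $M_p(\varphi^{\mathrm{simp}},K)$ be the matrix, in the basis of (oriented) $p$-simplices of $K$, of the composite $C_p(K;\mathbb{Q})\to C_p(K';\mathbb{Q})\to C_p(K;\mathbb{Q})$ of the subdivision operator with the chain map induced by $\varphi^{\mathrm{simp}}$. Let $M_p(\varphi^{\mathrm{simp}},K)_{|A}$ be the submatrix with rows and columns indexed by the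 $p$-simplices whose interior is contained in $A$. Define $$\varLambda(l,D)_Z:=\sum_p(-1)^p\,\mathrm{tr}\bigl(M_p(\varphi^{\mathrm{simp}},K)_{|A}\bigr).$$ It is independent of the choices when $l$ is open, $l(D)\subset D$ and $l(Z\setminus D)\subset Z\setminus D$. The number $\varLambda_{\mathrm{comb}}$. Let $U\subset\mathbb{R}^n$ be definable and $f:U\to U$ continuous. If there exist a definable compactification $X$ of $U$ and an open extension $f':X\to X$ of $f$ with $f'(X\setminus U)\subset X\setminus U$, define $\varLambda_{\mathrm{comb}}(f,U)=\varLambda(f',U)_X$. This is independent of the choice of $X$ and $f'$. If $U$ is definable, closed in $\mathbb{R}^n$ and unbounded and $f:U\to U$ is a homeomorphism, then $\varLambda_{\mathrm{comb}}(f,U)$ is always defined, by taking $X=U^\infty$ and the extension of $f$ fixing $\infty$. *)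

theory Defs
  imports "HOL-Analysis.Analysis" "HOL-Combinatorics.Combinatorics"
    "Jordan_Normal_Form.Determinant"
begin

section \<open>O-minimal structures\<close>

text \<open>Since the dimension has to vary inside the definitions (a structure is a family indexed by
  the dimension; compactifications and complexes may live in any \<open>R\<^sup>m\<close>), the space \<open>R\<^sup>n\<close> is
  \<^term>\<open>topspace (Euclidean_space n)\<close>, the sequences that vanish from index \<open>n\<close> on. On it the
  product topology of the type \<^typ>\<open>nat \<Rightarrow> real\<close> is the usual topology.\<close>

type_synonym point = "nat \<Rightarrow> real"

abbreviation Rn :: "nat \<Rightarrow> point set" where
  "Rn n \<equiv> topspace (Euclidean_space n)"

text \<open>The two sets in the second axiom are \<open>A \<times> R\<close> and \<open>R \<times> A\<close>; the map \<open>x \<mapsto> x(n := 0)\<close> forgets the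
  last coordinate of \<open>R\<^sup>n\<^sup>+\<^sup>1\<close>. The intervals in the last axiom may be points. The algebra
  locale of \<open>Sigma_Algebra\<close> (Boolean algebras of sets) is qualified because \<open>HOL-Algebra\<close> has
  another locale of that name.\<close>

definition o_minimal_structure :: "(nat \<Rightarrow> point set set) \<Rightarrow> bool" where
  "o_minimal_structure S \<longleftrightarrow>
     (\<forall>n. Sigma_Algebra.algebra (Rn n) (S n)) \<and>
     (\<forall>n. \<forall>A\<in>S n. {x \<in> Rn (Suc n). x(n := 0) \<in> A} \<in> S (Suc n) \<and>
                  {x \<in> Rn (Suc n). (\<lambda>i. x (Suc i)) \<in> A} \<in> S (Suc n)) \<and>
     (\<forall>n. \<forall>i<n. \<forall>j<n. {x \<in> Rn n. x i = x j} \<in> S n) \<and>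
     (\<forall>n. \<forall>A\<in>S (Suc n). (\<lambda>x. x(n := 0)) ` A \<in> S n) \<and>
     {x \<in> Rn 2. x 0 < x 1} \<in> S 2 \<and>
     (\<forall>a. {x \<in> Rn 1. x 0 = a} \<in> S 1) \<and>
     (\<forall>A\<in>S 1. \<exists>F. finite F \<and> (\<forall>I\<in>F. is_interval I) \<and> (\<lambda>x. x 0) ` A = \<Union>F)"

definition semilinear_sets :: "nat \<Rightarrow> point set set" where
  "semilinear_sets n = Sigma_Algebra.algebra (Rn n) hull
     {{x \<in> Rn n. (\<Sum>i<n. a i * x i) + b > 0} | a b. True}"

text \<open>The graph is taken in \<open>R\<^sup>m\<^sup>+\<^sup>n\<close>, by concatenating coordinates.\<close>

definition definable_map ::
  "(nat \<Rightarrow> point set set) \<Rightarrow> nat \<Rightarrow> nat \<Rightarrow> point set \<Rightarrow> (point \<Rightarrow> point) \<Rightarrow> bool" where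
  "definable_map S m n A f \<longleftrightarrow> A \<subseteq> Rn m \<and> f ` A \<subseteq> Rn n \<and>
     {(\<lambda>i. if i < m then x i else f x (i - m)) | x. x \<in> A} \<in> S (m + n)"

definition definable_homeomorphism ::
  "(nat \<Rightarrow> point set set) \<Rightarrow> nat \<Rightarrow> nat \<Rightarrow> point set \<Rightarrow> point set \<Rightarrow>
     (point \<Rightarrow> point) \<Rightarrow> (point \<Rightarrow> point) \<Rightarrow> bool" where
  "definable_homeomorphism S m n A B f g \<longleftrightarrow> homeomorphism A B f g \<and> definable_map S m n A f"


section \<open>Geometric simplicial complexes in \<open>R\<^sup>N\<close>\<close>

text \<open>The library's simplices and complexes live in a fixed type of class
  \<^class>\<open>euclidean_space\<close>, of which \<^typ>\<open>nat \<Rightarrow> real\<close> is not an instance. Here a simplex is given by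
  its finite set \<open>V\<close> of vertices, and a complex is the set of the vertex sets of its simplices; a
  \<open>p\<close>-simplex is a \<open>V\<close> with \<open>p + 1\<close> elements.\<close>

definition lin_comb :: "(point \<Rightarrow> real) \<Rightarrow> point set \<Rightarrow> point" where
  "lin_comb c V = (\<lambda>i. \<Sum>v\<in>V. c v * v i)"

definition affinely_independent :: "point set \<Rightarrow> bool" where
  "affinely_independent V \<longleftrightarrow> finite V \<and>
     (\<forall>c. sum c V = 0 \<and> lin_comb c V = (\<lambda>i. 0) \<longrightarrow> (\<forall>v\<in>V. c v = 0))"

definition closed_simplex :: "point set \<Rightarrow> point set" where
  "closed_simplex V = {lin_comb c V | c. (\<forall>v\<in>V. 0 \<le> c v) \<and> sum c V = 1}"

definition open_simplex :: "point set \<Rightarrow> point set" where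
  "open_simplex V = {lin_comb c V | c. (\<forall>v\<in>V. 0 < c v) \<and> sum c V = 1}"

definition barycentric :: "point set \<Rightarrow> point \<Rightarrow> point \<Rightarrow> real" where
  "barycentric V x = (THE c. (\<forall>v. v \<notin> V \<longrightarrow> c v = 0) \<and> sum c V = 1 \<and> lin_comb c V = x)"

definition geometric_complex :: "nat \<Rightarrow> point set set \<Rightarrow> bool" where
  "geometric_complex N K \<longleftrightarrow> finite K \<and>
     (\<forall>V\<in>K. V \<noteq> {} \<and> V \<subseteq> Rn N \<and> affinely_independent V) \<and>
     (\<forall>V\<in>K. \<forall>W. W \<noteq> {} \<and> W \<subseteq> V \<longrightarrow> W \<in> K) \<and>
     (\<forall>V\<in>K. \<forall>W\<in>K. closed_simplex V \<inter> closed_simplex W = closed_simplex (V \<inter> W))"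

definition polyhedron :: "point set set \<Rightarrow> point set" where
  "polyhedron K = (\<Union>V\<in>K. closed_simplex V)"

definition open_star :: "point set set \<Rightarrow> point \<Rightarrow> point set" where
  "open_star K v = (\<Union>V\<in>{V\<in>K. v \<in> V}. open_simplex V)"

definition subdivision :: "nat \<Rightarrow> point set set \<Rightarrow> point set set \<Rightarrow> bool" where
  "subdivision N K' K \<longleftrightarrow> geometric_complex N K' \<and> geometric_complex N K \<and>
     (\<forall>W\<in>K'. \<exists>V\<in>K. closed_simplex W \<subseteq> closed_simplex V) \<and>
     (\<forall>V\<in>K. \<exists>L\<subseteq>K'. closed_simplex V = (\<Union>W\<in>L. closed_simplex W))"

text \<open>A simplicial map is given by its effect \<open>g\<close> on vertices; the approximation property is the
  star condition.\<close>

definition simplicial_approximation ::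
  "point set set \<Rightarrow> point set set \<Rightarrow> (point \<Rightarrow> point) \<Rightarrow> (point \<Rightarrow> point) \<Rightarrow> bool" where
  "simplicial_approximation K' K g \<phi> \<longleftrightarrow>
     (\<forall>W\<in>K'. g ` W \<in> K) \<and> (\<forall>v\<in>\<Union>K'. \<phi> ` open_star K' v \<subseteq> open_star K (g v))"

text \<open>\<open>C\<close> is a set of (vertex sets of) simplices of a finite complex \<open>L\<close>, and \<open>A\<close> is triangulated by
  the union of the open simplices in \<open>C\<close>; the largest dimension occurring in \<open>C\<close> is \<open>d\<close>.\<close>

definition definable_dimension :: "(nat \<Rightarrow> point set set) \<Rightarrow> nat \<Rightarrow> point set \<Rightarrow> nat \<Rightarrow> bool" where
  "definable_dimension S n A d \<longleftrightarrow>
     (\<exists>N L C \<tau> \<tau>'. geometric_complex N L \<and> C \<subseteq> L \<and>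
        definable_homeomorphism S N n (\<Union>V\<in>C. open_simplex V) A \<tau> \<tau>' \<and>
        (\<forall>V\<in>C. card V \<le> d + 1) \<and> (\<exists>V\<in>C. card V = d + 1))"


section \<open>Chain maps and the combinatorial Lefschetz number\<close>

text \<open>An orientation of each simplex is fixed by listing its vertices. The oriented \<open>p\<close>-simplices
  form the basis of the chain space \<open>C\<^sub>p\<close>, and chain maps are given by their rational matrices in these
  bases.\<close>

definition orientation :: "point set set \<Rightarrow> (point set \<Rightarrow> point list) \<Rightarrow> bool" where
  "orientation K ori \<longleftrightarrow> (\<forall>V\<in>K. distinct (ori V) \<and> set (ori V) = V)"

text \<open>The subdivision operator sends an oriented \<open>p\<close>-simplex \<open>[v\<^sub>0, \<dots>, v\<^sub>p]\<close> to the sum of the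
  \<open>p\<close>-simplices of the subdivision that it contains, each oriented compatibly. The coefficient of
  \<open>[w\<^sub>0, \<dots>, w\<^sub>p]\<close> is therefore the sign of the determinant of the barycentric coordinates of the
  \<open>w\<^sub>j\<close> with respect to the \<open>v\<^sub>i\<close>.\<close>

definition subdivision_coeff :: "point list \<Rightarrow> point list \<Rightarrow> rat" where
  "subdivision_coeff ws vs =
     (if length ws = length vs \<and> closed_simplex (set ws) \<subseteq> closed_simplex (set vs) then
        (if Determinant.det (Matrix.mat (length vs) (length vs)
               (\<lambda>(i, j). barycentric (set vs) (ws ! j) (vs ! i))) > 0 then 1 else -1)
      else 0)"

text \<open>The coefficient of \<open>[v\<^sub>0, \<dots>, v\<^sub>p]\<close> in the image \<open>[g w\<^sub>0, \<dots>, g w\<^sub>p]\<close>, which is \<open>0\<close> when \<open>g\<close>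
  identifies two of the \<open>w\<^sub>j\<close>. As the \<open>v\<^sub>i\<close> are distinct, the sum has at most one term.\<close>

definition simplicial_coeff :: "(point \<Rightarrow> point) \<Rightarrow> point list \<Rightarrow> point list \<Rightarrow> rat" where
  "simplicial_coeff g vs ws =
     (\<Sum>\<pi> | \<pi> permutes {..<length vs} \<and> map g ws = permute_list \<pi> vs. of_int (sign \<pi>))"

text \<open>The entry of \<open>M\<^sub>p\<close> in row \<open>V\<close> and column \<open>W\<close> for \<open>p\<close>-simplices \<open>V\<close> and \<open>W\<close> of \<open>K\<close>.\<close>

definition M_entry ::
  "point set set \<Rightarrow> (point set \<Rightarrow> point list) \<Rightarrow> (point set \<Rightarrow> point list) \<Rightarrow>
     (point \<Rightarrow> point) \<Rightarrow> nat \<Rightarrow> point set \<Rightarrow> point set \<Rightarrow> rat" where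
  "M_entry K' ori' ori g p V W =
     (\<Sum>T | T \<in> K' \<and> card T = p + 1.
        simplicial_coeff g (ori V) (ori' T) * subdivision_coeff (ori' T) (ori W))"

definition lefschetz_sum ::
  "point set set \<Rightarrow> point set set \<Rightarrow> (point set \<Rightarrow> point list) \<Rightarrow> (point set \<Rightarrow> point list) \<Rightarrow>
     (point \<Rightarrow> point) \<Rightarrow> point set \<Rightarrow> rat" where
  "lefschetz_sum K K' ori ori' g A =
     (\<Sum>p<card (\<Union>K). (-1) ^ p *
        (\<Sum>V | V \<in> K \<and> card V = p + 1 \<and> open_simplex V \<subseteq> A. M_entry K' ori' ori g p V V))"

text \<open>\<open>has_Lambda S m Z D l q\<close> means \<open>\<Lambda>(l, D)\<^sub>Z = q\<close>, for a compact definable set \<open>Z\<close> in \<open>R\<^sup>m\<close>, and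
  \<open>has_Lambda_comb S n f U q\<close> below means that \<open>\<Lambda>\<^sub>c\<^sub>o\<^sub>m\<^sub>b(f, U)\<close> is defined and equal to \<open>q\<close>. Both numbers
  are partially defined and computed from auxiliary choices, so they are relations, saying that
  \<open>q\<close> is the value computed from some choice.\<close>

definition has_Lambda ::
  "(nat \<Rightarrow> point set set) \<Rightarrow> nat \<Rightarrow> point set \<Rightarrow> point set \<Rightarrow> (point \<Rightarrow> point) \<Rightarrow> rat \<Rightarrow> bool" where
  "has_Lambda S m Z D l q \<longleftrightarrow>
     Z \<in> S m \<and> compact Z \<and> D \<in> S m \<and> D \<subseteq> Z \<and>
     continuous_map (top_of_set Z) (top_of_set Z) l \<and>
     (\<exists>N K \<tau> \<tau>' A K' g ori ori'.
        geometric_complex N K \<and>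
        definable_homeomorphism S N m (polyhedron K) Z \<tau> \<tau>' \<and>
        A = {x \<in> polyhedron K. \<tau> x \<in> D} \<and>
        (\<exists>C\<subseteq>K. A = (\<Union>V\<in>C. open_simplex V)) \<and>
        subdivision N K' K \<and>
        simplicial_approximation K' K g (\<tau>' \<circ> l \<circ> \<tau>) \<and>
        orientation K ori \<and> orientation K' ori' \<and>
        q = lefschetz_sum K K' ori ori' g A)"

text \<open>A definable compactification of \<open>U\<close> is a compact definable set \<open>X\<close> in some \<open>R\<^sup>m\<close> together with a
  definable embedding \<open>j\<close> (the inclusion) of \<open>U\<close> onto a dense subset of \<open>X\<close>.\<close>

definition definable_compactification ::
  "(nat \<Rightarrow> point set set) \<Rightarrow> nat \<Rightarrow> point set \<Rightarrow> nat \<Rightarrow> point set \<Rightarrow> (point \<Rightarrow> point) \<Rightarrow> bool" where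
  "definable_compactification S n U m X j \<longleftrightarrow>
     U \<in> S n \<and> X \<in> S m \<and> compact X \<and>
     j ` U \<subseteq> X \<and> X \<subseteq> closure (j ` U) \<and>
     (\<exists>j'. definable_homeomorphism S n m U (j ` U) j j')"

definition has_Lambda_comb ::
  "(nat \<Rightarrow> point set set) \<Rightarrow> nat \<Rightarrow> (point \<Rightarrow> point) \<Rightarrow> point set \<Rightarrow> rat \<Rightarrow> bool" where
  "has_Lambda_comb S n f U q \<longleftrightarrow>
     U \<in> S n \<and> continuous_map (top_of_set U) (top_of_set U) f \<and>
     (\<exists>m X j f'.
        definable_compactification S n U m X j \<and>
        continuous_map (top_of_set X) (top_of_set X) f' \<and>
        open_map (top_of_set X) (top_of_set X) f' \<and>
        (\<forall>x\<in>U. f' (j x) = j (f x)) \<and>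
        f' ` (X - j ` U) \<subseteq> X - j ` U \<and>
        has_Lambda S m X (j ` U) f' q)"

end

theory Submission
  imports Defs
begin

text \<open>Suppose that \<open>f\<close> has no fixed point. As \<open>U\<close> is dense in the compactification and of dimension 1,
  the triangulating complex \<open>K\<close> is a graph, and the self-map \<open>\<phi>\<close> of \<open>K\<close> has no fixed point in \<open>A\<close>.
  On an edge \<open>e = [0, 1]\<close> contained in \<open>A\<close>, collapse the complement of the open edge and lift to a map
  \<open>F\<close> from \<open>[0, 1]\<close> to the reals: \<open>F t - t\<close> is an integer only at fixed points, so it stays between
  two consecutive integers. Hence the entry of \<open>M\<^sub>1\<close> at \<open>e\<close>, the number of times that the approximation
  of \<open>\<phi>\<close> runs through \<open>e\<close>, is at least the number of end points \<open>v\<close> of \<open>e\<close> with \<open>g v = v\<close> and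
  \<open>\<phi> v\<close> in the open edge. Every vertex in \<open>A\<close> fixed by the approximation \<open>g\<close> is such an end point of
  exactly one edge, so \<open>tr M\<^sub>0 \<le> tr M\<^sub>1\<close> and the Lefschetz number is not positive.\<close>

section \<open>Simplices\<close>

lemma lin_comb_restrict:
  "lin_comb (\<lambda>v. if v \<in> W then c v else 0) V = lin_comb c W" if "finite V" "W \<subseteq> V"
  unfolding lin_comb_def using that
  by (intro ext sum.mono_neutral_cong_right) auto

lemma sum_restrict:
  "sum (\<lambda>v. if v \<in> W then c v else 0) V = sum c W" if "finite V" "W \<subseteq> V"
  for c :: "'a \<Rightarrow> real"
  using that by (intro sum.mono_neutral_cong_right) auto

lemma affinely_independent_unique:
  assumes "affinely_independent V" "sum c V = sum d V" "lin_comb c V = lin_comb d V" "v \<in> V"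
  shows "c v = d v"
proof -
  have "sum (\<lambda>v. c v - d v) V = 0" "lin_comb (\<lambda>v. c v - d v) V = (\<lambda>i. 0)"
    using assms(2) fun_cong[OF assms(3)]
    by (auto simp: sum_subtractf lin_comb_def left_diff_distrib)
  then show ?thesis using assms(1,4) unfolding affinely_independent_def by force
qed

lemma barycentric_eqI:
  assumes "affinely_independent V" "\<And>v. v \<notin> V \<Longrightarrow> c v = 0" "sum c V = 1" "lin_comb c V = x"
  shows "barycentric V x = c"
  unfolding barycentric_def
proof (rule the_equality)
  fix d assume d: "(\<forall>v. v \<notin> V \<longrightarrow> d v = 0) \<and> sum d V = 1 \<and> lin_comb d V = x"
  show "d = c"
  proof
    fix v show "d v = c v"
      using affinely_independent_unique[OF assms(1), of d c v] d assms by (cases "v \<in> V") auto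
  qed
qed (use assms in auto)

text \<open>Coordinates with respect to \<open>W\<close>, extended by zero, are coordinates with
  respect to \<open>V\<close>. By uniqueness they are all positive, so no vertex of \<open>V\<close>
  is missing from \<open>W\<close>.\<close>

lemma face_meets_open_simplex:
  assumes "affinely_independent V" "W \<subseteq> V" "x \<in> open_simplex V" "x \<in> closed_simplex W"
  shows "W = V"
proof -
  have fin: "finite V" using assms(1) by (simp add: affinely_independent_def)
  obtain c where c: "\<forall>v\<in>V. 0 < c v" "sum c V = 1" "x = lin_comb c V"
    using assms(3) by (auto simp: open_simplex_def)
  obtain d where d: "sum d W = 1" "x = lin_comb d W"
    using assms(4) by (auto simp: closed_simplex_def)
  have "c v = (if v \<in> W then d v else 0)" if "v \<in> V" for v
    using affinely_independent_unique[OF assms(1), of c "\<lambda>v. if v \<in> W then d v else 0" v] that c d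
    by (simp add: lin_comb_restrict[OF fin assms(2)] sum_restrict[OF fin assms(2)])
  then have "V \<subseteq> W" using c(1) by (metis less_irrefl subsetI)
  then show ?thesis using assms(2) by blast
qed

lemma open_simplex_subset_closed: "open_simplex V \<subseteq> closed_simplex V"
  unfolding open_simplex_def closed_simplex_def by (auto intro: less_imp_le)

lemma closed_simplex_empty [simp]: "closed_simplex {} = {}"
  by (simp add: closed_simplex_def)

lemma closed_simplex_mono:
  assumes "finite V" "W \<subseteq> V" shows "closed_simplex W \<subseteq> closed_simplex V"
proof
  fix x assume "x \<in> closed_simplex W"
  then obtain c where c: "\<forall>v\<in>W. 0 \<le> c v" "sum c W = 1" "x = lin_comb c W"
    by (auto simp: closed_simplex_def)
  then show "x \<in> closed_simplex V"
    unfolding closed_simplex_def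
    using lin_comb_restrict[OF assms, of c] sum_restrict[OF assms, of c]
    by (intro CollectI exI[of _ "\<lambda>v. if v \<in> W then c v else 0"]) auto
qed

lemma closed_simplex_singleton [simp]: "closed_simplex {v} = {v}"
proof -
  have "lin_comb (\<lambda>_. 1) {v} = v" "\<And>c. c v = 1 \<Longrightarrow> lin_comb c {v} = v"
    by (auto simp: lin_comb_def)
  then show ?thesis unfolding closed_simplex_def
    by (auto intro: exI[of _ "\<lambda>_. 1"])
qed

lemma open_simplex_singleton [simp]: "open_simplex {v} = {v}"
proof -
  have "lin_comb (\<lambda>_. 1) {v} = v" "\<And>c. c v = 1 \<Longrightarrow> lin_comb c {v} = v"
    by (auto simp: lin_comb_def)
  then show ?thesis unfolding open_simplex_def
    by (auto intro: exI[of _ "\<lambda>_. 1"])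
qed

lemma vertex_in_closed_simplex: "finite V \<Longrightarrow> v \<in> V \<Longrightarrow> v \<in> closed_simplex V"
  using closed_simplex_mono[of V "{v}"] by auto

lemma open_simplex_nonempty:
  assumes "finite V" "V \<noteq> {}" obtains x where "x \<in> open_simplex V"
proof -
  have "lin_comb (\<lambda>_. 1 / card V) V \<in> open_simplex V"
    using assms unfolding open_simplex_def
    by (intro CollectI exI[of _ "\<lambda>_. 1 / card V"]) (auto simp: card_gt_0_iff)
  then show ?thesis using that by blast
qed

section \<open>Segments and simplices with two vertices\<close>

definition segment_point :: "point \<Rightarrow> point \<Rightarrow> real \<Rightarrow> point" where
  "segment_point a b t = (\<lambda>i. (1 - t) * a i + t * b i)"

text \<open>For \<open>a \<noteq> b\<close>, reading one coordinate in which they differ gives an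
  affine, continuous function on the whole space that inverts \<open>segment_point a b\<close> on
  the line. Off the line its values depend on the index chosen.\<close>

definition segment_coord :: "point \<Rightarrow> point \<Rightarrow> point \<Rightarrow> real" where
  "segment_coord a b x = (let i = (SOME i. a i \<noteq> b i) in (x i - a i) / (b i - a i))"

lemma segment_coord_point [simp]:
  assumes "a \<noteq> b" shows "segment_coord a b (segment_point a b t) = t"
proof -
  have "\<exists>i. a i \<noteq> b i" using assms by auto
  from someI_ex[OF this] show ?thesis
    by (simp add: segment_coord_def segment_point_def Let_def divide_simps) (simp add: algebra_simps)
qed

lemma segment_point_eq_iff: "a \<noteq> b \<Longrightarrow> segment_point a b s = segment_point a b t \<longleftrightarrow> s = t"
  by (metis segment_coord_point)

lemma segment_point_0 [simp]: "segment_point a b 0 = a"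
  and segment_point_1 [simp]: "segment_point a b 1 = b"
  by (auto simp: segment_point_def)

lemma continuous_on_segment_point: "continuous_on T (segment_point a b)"
  unfolding segment_point_def
  by (intro continuous_on_coordinatewise_then_product continuous_intros)

lemma continuous_on_segment_coord: "continuous_on T (segment_coord a b)"
  unfolding segment_coord_def Let_def divide_inverse
  by (intro continuous_intros continuous_on_product_coordinates[THEN continuous_on_subset]) auto

lemma lin_comb_pair: "a \<noteq> b \<Longrightarrow> lin_comb c {a, b} = (\<lambda>i. c a * a i + c b * b i)"
  by (simp add: lin_comb_def)

lemma closed_simplex_pair:
  assumes "a \<noteq> b" shows "closed_simplex {a, b} = segment_point a b ` {0..1}"
proof (intro equalityI subsetI)
  fix x assume "x \<in> closed_simplex {a, b}"
  then obtain c where "0 \<le> c a" "0 \<le> c b" "c a + c b = 1" "x = lin_comb c {a, b}"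
    using assms by (auto simp: closed_simplex_def)
  then have "x = segment_point a b (c b)" "c b \<in> {0..1}"
    using assms by (auto simp: lin_comb_pair segment_point_def eq_diff_eq[symmetric])
  then show "x \<in> segment_point a b ` {0..1}" by blast
next
  fix x assume "x \<in> segment_point a b ` {0..1}"
  then obtain t where "t \<in> {0..1}" "x = segment_point a b t" by auto
  then show "x \<in> closed_simplex {a, b}"
    using assms unfolding closed_simplex_def
    by (intro CollectI exI[of _ "\<lambda>v. if v = b then t else 1 - t"])
       (auto simp: lin_comb_pair segment_point_def)
qed

lemma open_simplex_pair:
  assumes "a \<noteq> b" shows "open_simplex {a, b} = segment_point a b ` {0<..<1}"
proof (intro equalityI subsetI)
  fix x assume "x \<in> open_simplex {a, b}"
  then obtain c where "0 < c a" "0 < c b" "c a + c b = 1" "x = lin_comb c {a, b}"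
    using assms by (auto simp: open_simplex_def)
  then have "x = segment_point a b (c b)" "c b \<in> {0<..<1}"
    using assms by (auto simp: lin_comb_pair segment_point_def eq_diff_eq[symmetric])
  then show "x \<in> segment_point a b ` {0<..<1}" by blast
next
  fix x assume "x \<in> segment_point a b ` {0<..<1}"
  then obtain t where "t \<in> {0<..<1}" "x = segment_point a b t" by auto
  then show "x \<in> open_simplex {a, b}"
    using assms unfolding open_simplex_def
    by (intro CollectI exI[of _ "\<lambda>v. if v = b then t else 1 - t"])
       (auto simp: lin_comb_pair segment_point_def)
qed

lemma closed_simplex_segment:
  assumes "a \<noteq> b" "x < y"
  shows "closed_simplex {segment_point a b x, segment_point a b y} = segment_point a b ` {x..y}"
proof -
  have 1: "segment_point (segment_point a b x) (segment_point a b y) t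
      = segment_point a b ((1 - t) * x + t * y)" for t
    by (auto simp: segment_point_def algebra_simps)
  have 2: "(\<lambda>t. (1 - t) * x + t * y) ` {0..1} = {x..y}"
  proof -
    have "(\<lambda>t. (1 - t) * x + t * y) = (\<lambda>t. (y - x) * t + x)" by (auto simp: algebra_simps)
    then show ?thesis using assms(2) by (simp only:) (simp add: image_affinity_atLeastAtMost)
  qed
  show ?thesis
    using assms by (subst closed_simplex_pair) (auto simp: segment_point_eq_iff 1 2[symmetric] image_image)
qed

lemma open_simplex_segment:
  assumes "a \<noteq> b" "x < y"
  shows "open_simplex {segment_point a b x, segment_point a b y} = segment_point a b ` {x<..<y}"
proof -
  have 1: "segment_point (segment_point a b x) (segment_point a b y) t
      = segment_point a b ((1 - t) * x + t * y)" for t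
    by (auto simp: segment_point_def algebra_simps)
  have 2: "(\<lambda>t. (1 - t) * x + t * y) ` {0<..<1} = {x<..<y}" (is "?h ` _ = _")
  proof (intro equalityI subsetI)
    fix z assume "z \<in> ?h ` {0<..<1}"
    then obtain t where t: "0 < t" "t < 1" "z = (1 - t) * x + t * y" by auto
    then have "z - x = t * (y - x)" "y - z = (1 - t) * (y - x)" by (auto simp: algebra_simps)
    then have "0 < z - x" "0 < y - z" using t assms(2) by simp_all
    then show "z \<in> {x<..<y}" by simp
  next
    fix z assume z: "z \<in> {x<..<y}"
    have "?h w = x + w * (y - x)" for w by (simp add: algebra_simps)
    from this[of "(z - x) / (y - x)"] have "?h ((z - x) / (y - x)) = z" using assms(2) by simp
    then have "z = ?h ((z - x) / (y - x))" and "(z - x) / (y - x) \<in> {0<..<1}"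
      using assms(2) z by auto
    then show "z \<in> ?h ` {0<..<1}" by blast
  qed
  show ?thesis
    using assms by (subst open_simplex_pair) (auto simp: segment_point_eq_iff 1 2[symmetric] image_image)
qed

lemma card_le_2_cases:
  assumes "finite V" "V \<noteq> {}" "card V \<le> 2"
  obtains v where "V = {v}" | a b where "a \<noteq> b" "V = {a, b}"
proof -
  have "card V = 1 \<or> card V = 2" using assms card_gt_0_iff[of V] by linarith
  then show ?thesis using that by (metis card_1_singletonE card_2_iff)
qed

lemma compact_closed_simplex:
  assumes "finite V" "V \<noteq> {}" "card V \<le> 2" shows "compact (closed_simplex V)"
  by (rule card_le_2_cases[OF assms])
     (auto simp: closed_simplex_pair continuous_on_segment_point intro!: compact_continuous_image)

lemma barycentric_pair:
  assumes "affinely_independent {a, b}" "a \<noteq> b"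
  shows "barycentric {a, b} (segment_point a b t) a = 1 - t"
    and "barycentric {a, b} (segment_point a b t) b = t"
proof -
  have "barycentric {a, b} (segment_point a b t)
      = (\<lambda>v. if v = a then 1 - t else if v = b then t else 0)"
    using assms by (intro barycentric_eqI) (auto simp: lin_comb_pair segment_point_def)
  then show "barycentric {a, b} (segment_point a b t) a = 1 - t"
    "barycentric {a, b} (segment_point a b t) b = t" using assms(2) by auto
qed

section \<open>Matrix entries in dimensions 0 and 1\<close>

lemma det_mat_2:
  "Determinant.det (Matrix.mat 2 2 f) = f (0, 0) * f (1, 1) - f (0, 1) * (f (1, 0) :: real)"
proof -
  have 1: "{0..<2} = {0, 1 :: nat}" by auto
  have 2: "id \<noteq> Transposition.transpose 0 (1 :: nat)"
    by (metis id_apply transpose_apply_first zero_neq_one)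
  have 3: "{p. p permutes {0..<2}} = {id, Transposition.transpose 0 (1 :: nat)}"
    by (auto simp: 1 permutes_doubleton_iff)
  show ?thesis
    by (subst det_def'[of _ 2], simp, subst 3) (use 2 in \<open>simp add: 1 sign_swap_id\<close>)
qed

text \<open>The columns of barycentric coordinates are \<open>(1 - x, x)\<close> and
  \<open>(1 - y, y)\<close>, so the determinant is \<open>y - x\<close>.\<close>

lemma subdivision_coeff_pair:
  assumes "affinely_independent {a, b}" "a \<noteq> b" "0 \<le> x" "x \<le> 1" "0 \<le> y" "y \<le> 1" "x \<noteq> y"
  shows "subdivision_coeff [segment_point a b x, segment_point a b y] [a, b] = (if x < y then 1 else -1)"
proof -
  have "closed_simplex {segment_point a b x, segment_point a b y} \<subseteq> closed_simplex {a, b}"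
    using assms closed_simplex_segment[of a b x y] closed_simplex_segment[of a b y x]
    by (cases "x < y") (auto simp: closed_simplex_pair insert_commute)
  moreover have "Determinant.det (Matrix.mat 2 2 (\<lambda>(i, j).
     barycentric {a, b} ([segment_point a b x, segment_point a b y] ! j) ([a, b] ! i))) = y - x"
    by (subst det_mat_2) (simp add: barycentric_pair[OF assms(1,2)] algebra_simps)
  ultimately show ?thesis using assms(7) by (simp add: subdivision_coeff_def numeral_2_eq_2)
qed

lemma subdivision_coeff_singleton:
  assumes "affinely_independent {v}"
  shows "subdivision_coeff [w] [v] = of_bool (w = v)"
proof -
  have "barycentric {v} v = (\<lambda>u. if u = v then 1 else 0)"
    using assms by (intro barycentric_eqI) (auto simp: lin_comb_def)
  then show ?thesis
    by (auto simp: subdivision_coeff_def det_single)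
qed

lemma simplicial_coeff_singleton: "simplicial_coeff g [v] [w] = of_bool (g w = v)"
proof -
  have "{\<pi>. \<pi> permutes {..<Suc 0} \<and> map g [w] = permute_list \<pi> [v]}
      = (if g w = v then {id} else {})"
    by (auto simp: permute_list_def lessThan_Suc)
  then show ?thesis by (simp add: simplicial_coeff_def)
qed

lemma simplicial_coeff_pair:
  assumes "a \<noteq> b"
  shows "simplicial_coeff g [a, b] [u, w]
    = of_bool (g u = a \<and> g w = b) - of_bool (g u = b \<and> g w = a)"
proof -
  have 1: "{..<Suc (Suc 0)} = {0, 1 :: nat}" by auto
  have 2: "id \<noteq> Transposition.transpose 0 (Suc 0)"
    by (metis id_apply transpose_apply_first zero_neq_one One_nat_def)
  have "{\<pi>. \<pi> permutes {..<Suc (Suc 0)} \<and> map g [u, w] = permute_list \<pi> [a, b]}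
      = (if g u = a \<and> g w = b then {id}
         else if g u = b \<and> g w = a then {Transposition.transpose 0 1} else {})"
    using assms by (auto simp: permute_list_def 1 permutes_doubleton_iff upt_rec)
  then show ?thesis using assms by (auto simp: simplicial_coeff_def sign_swap_id)
qed

lemma distinct_set_pair:
  assumes "distinct l" "set l = {u, w}" "u \<noteq> w" shows "l = [u, w] \<or> l = [w, u]"
proof -
  have "length l = 2" using distinct_card[OF assms(1)] assms(2,3) by simp
  then obtain x y where "l = [x, y]" by (auto simp: numeral_2_eq_2 length_Suc_conv)
  then show ?thesis using assms by (auto simp: doubleton_eq_iff)
qed

section \<open>Consecutive points and integer values of continuous functions\<close>

definition consecutive :: "'a::linorder set \<Rightarrow> ('a \<times> 'a) set" where
  "consecutive B = {(x, y). x \<in> B \<and> y \<in> B \<and> x < y \<and> (\<forall>z\<in>B. \<not> (x < z \<and> z < y))}"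

lemma finite_consecutive: "finite B \<Longrightarrow> finite (consecutive B)"
  by (rule finite_subset[of _ "B \<times> B"]) (auto simp: consecutive_def)

text \<open>The sum telescopes: adding a new maximum \<open>b\<close> to a nonempty set
  \<open>A\<close> creates exactly one new pair, \<open>(Max A, b)\<close>.\<close>

lemma sum_consecutive:
  fixes h :: "'a::linorder \<Rightarrow> 'b::ab_group_add"
  assumes "finite B" "B \<noteq> {}"
  shows "(\<Sum>(x, y)\<in>consecutive B. h x - h y) = h (Min B) - h (Max B)"
  using assms
proof (induction B rule: finite_linorder_max_induct)
  case (insert b A)
  show ?case
  proof (cases "A = {}")
    case True
    have "consecutive {b} = {}" by (auto simp: consecutive_def)
    with True show ?thesis by simp
  next
    case False
    have M: "Max A \<in> A" "\<And>x. x \<in> A \<Longrightarrow> x \<le> Max A" using insert False by auto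
    have "(x, y) \<in> consecutive (insert b A) \<longleftrightarrow> (x, y) = (Max A, b) \<or> (x, y) \<in> consecutive A" for x y
    proof (cases "y = b")
      case True
      have "(x, b) \<in> consecutive (insert b A) \<longleftrightarrow> x \<in> A \<and> (\<forall>z\<in>A. z \<le> x)"
        using insert.hyps(2) unfolding consecutive_def by (auto simp: not_less not_le[symmetric])
      also have "\<dots> \<longleftrightarrow> x = Max A" using M by (auto intro: antisym)
      finally show ?thesis using True insert.hyps(2) by (auto simp: consecutive_def)
    next
      case False
      then show ?thesis using insert.hyps(2) unfolding consecutive_def by (auto dest: less_asym)
    qed
    then have "consecutive (insert b A) = insert (Max A, b) (consecutive A)" by auto
    moreover have "(Max A, b) \<notin> consecutive A" using insert by (auto simp: consecutive_def)
    moreover have "Min (insert b A) = Min A"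
      using insert.hyps False Min_in[OF insert.hyps(1) False] by (simp add: min_absorb2 less_imp_le)
    moreover have "Max (insert b A) = b"
      using insert.hyps False M(1) by (simp add: max_absorb1 less_imp_le)
    ultimately show ?thesis
      using insert False by (simp add: finite_consecutive)
  qed
qed simp

text \<open>\<open>\<lceil>G x\<rceil> - 1\<close> is the greatest integer strictly below
  \<open>G x\<close>. If \<open>G t\<close> fell below it, the intermediate value theorem would give
  this integer as a value at some \<open>u > x\<close>. The strictness lets \<open>G x\<close>
  itself be an integer.\<close>

lemma ceiling_le_floor_of_no_integer_value:
  fixes G :: "real \<Rightarrow> real"
  assumes "x \<le> t" "continuous_on {x..t} G" "\<And>u. u \<in> {x<..t} \<Longrightarrow> G u \<notin> \<int>"
  shows "\<lceil>G x\<rceil> - 1 \<le> \<lfloor>G t\<rfloor>"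
proof (rule ccontr)
  assume "\<not> ?thesis"
  then have "G t \<le> of_int (\<lceil>G x\<rceil> - 1)" "of_int (\<lceil>G x\<rceil> - 1) < G x" by linarith+
  then obtain u where "x \<le> u" "u \<le> t" "G u = of_int (\<lceil>G x\<rceil> - 1)"
    using IVT2'[of G t "of_int (\<lceil>G x\<rceil> - 1)" x] assms by auto
  moreover from this have "u \<noteq> x" using \<open>of_int (\<lceil>G x\<rceil> - 1) < G x\<close> by auto
  ultimately show False using assms(3)[of u] by (metis Ints_of_int greaterThanAtMost_iff order_le_less)
qed

text \<open>The mirror image, with the exceptional point at the right end: a fall below
  \<open>\<lfloor>G t\<rfloor>\<close> would attain this integer at a point other than
  \<open>y\<close>, while \<open>G y\<close> itself may be an integer.\<close>

lemma floor_le_floor_of_no_integer_value: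
  fixes G :: "real \<Rightarrow> real"
  assumes "t \<le> y" "continuous_on {t..y} G" "\<And>u. u \<in> {t..<y} \<Longrightarrow> G u \<notin> \<int>"
  shows "\<lfloor>G t\<rfloor> \<le> \<lfloor>G y\<rfloor>"
proof (rule ccontr)
  assume "\<not> ?thesis"
  then have "G y < of_int \<lfloor>G t\<rfloor>" "of_int \<lfloor>G t\<rfloor> \<le> G t" by linarith+
  then obtain u where "t \<le> u" "u \<le> y" "G u = of_int \<lfloor>G t\<rfloor>"
    using IVT2'[of G y "of_int \<lfloor>G t\<rfloor>" t] assms by auto
  moreover from this have "u \<noteq> y" using \<open>G y < of_int \<lfloor>G t\<rfloor>\<close> by auto
  ultimately show False using assms(3)[of u] by (metis Ints_of_int atLeastLessThan_iff order_le_less)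
qed

lemma ceiling_minus_1_eq_floor: "x \<notin> \<int> \<Longrightarrow> \<lceil>x\<rceil> - 1 = \<lfloor>x\<rfloor>" for x :: real
  by (simp add: ceiling_altdef) (metis Ints_of_int)

section \<open>Geometric complexes\<close>

lemma complex_simplex:
  assumes "geometric_complex N K" "V \<in> K"
  shows "finite V" "V \<noteq> {}" "affinely_independent V"
proof -
  have "\<forall>V\<in>K. V \<noteq> {} \<and> V \<subseteq> Rn N \<and> affinely_independent V"
    using assms(1) unfolding geometric_complex_def by (elim conjE)
  then show "V \<noteq> {}" "affinely_independent V" using assms(2) by blast+
  then show "finite V" unfolding affinely_independent_def by (elim conjE)
qed

lemma complex_face:
  assumes "geometric_complex N K" "V \<in> K" "W \<noteq> {}" "W \<subseteq> V" shows "W \<in> K"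
proof -
  have "\<forall>V\<in>K. \<forall>W. W \<noteq> {} \<and> W \<subseteq> V \<longrightarrow> W \<in> K"
    using assms(1) unfolding geometric_complex_def by (elim conjE)
  then show ?thesis using assms(2-4) by blast
qed

lemma complex_Int:
  assumes "geometric_complex N K" "V \<in> K" "W \<in> K"
  shows "closed_simplex V \<inter> closed_simplex W = closed_simplex (V \<inter> W)"
proof -
  have "\<forall>V\<in>K. \<forall>W\<in>K. closed_simplex V \<inter> closed_simplex W = closed_simplex (V \<inter> W)"
    using assms(1) unfolding geometric_complex_def by (elim conjE)
  then show ?thesis using assms(2,3) by blast
qed

lemma complex_vertex: "geometric_complex N K \<Longrightarrow> v \<in> \<Union>K \<Longrightarrow> {v} \<in> K"
  by (auto intro: complex_face)

text \<open>\<open>x\<close> lies in the common face \<open>V \<inter> W\<close>, which therefore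
  meets the open simplex of \<open>V\<close> and is all of \<open>V\<close>.\<close>

lemma complex_carrier_minimal:
  assumes "geometric_complex N K" "V \<in> K" "W \<in> K" "x \<in> open_simplex V" "x \<in> closed_simplex W"
  shows "V \<subseteq> W"
proof -
  have "x \<in> closed_simplex (V \<inter> W)"
    using assms(4,5) open_simplex_subset_closed[of V] complex_Int[OF assms(1-3)] by blast
  then have "V \<inter> W = V"
    using face_meets_open_simplex[of V "V \<inter> W" x] assms complex_simplex(3)[OF assms(1,2)] by auto
  then show ?thesis by blast
qed

lemma complex_open_simplex_unique:
  assumes "geometric_complex N K" "V \<in> K" "W \<in> K" "x \<in> open_simplex V" "x \<in> open_simplex W"
  shows "V = W"
proof
  show "V \<subseteq> W" "W \<subseteq> V"
    using assms(4,5) open_simplex_subset_closed[of V] open_simplex_subset_closed[of W]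
    by (intro complex_carrier_minimal[OF assms(1)] assms(2,3); blast)+
qed

lemma complex_vertex_in_simplex:
  assumes "geometric_complex N K" "v \<in> \<Union>K" "W \<in> K" "v \<in> closed_simplex W"
  shows "v \<in> W"
  using complex_carrier_minimal[OF assms(1) complex_vertex[OF assms(1,2)] assms(3)] assms(4) by auto

section \<open>Simplicial approximations on an edge\<close>

lemma segment_point_outside_open_simplex:
  "a \<noteq> b \<Longrightarrow> t \<in> {0..1} \<Longrightarrow> segment_point a b t \<notin> open_simplex {a, b} \<Longrightarrow> t = 0 \<or> t = 1"
  by (force simp: open_simplex_pair)

text \<open>The displacement, along the edge \<open>ab\<close>, of a point \<open>x\<close> from the vertex \<open>v\<close> to whose open star
  it belongs.\<close>

definition edge_shift :: "point \<Rightarrow> point \<Rightarrow> point \<Rightarrow> point \<Rightarrow> real" where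
  "edge_shift a b v x =
     (if x \<in> open_simplex {a, b} then segment_coord a b x - of_bool (v = b) else 0)"

lemma edge_shift_segment_point:
  assumes "a \<noteq> b" "0 < t" "t < 1"
  shows "edge_shift a b v (segment_point a b t) = t - of_bool (v = b)"
  using assms by (simp add: edge_shift_def open_simplex_pair)

text \<open>Two closed pieces of the star are glued: the closed edge, and the union of the other
  closed simplices, where the shift is 0. An end point of the edge lies in the open star of
  \<open>v\<close> only if it is \<open>v\<close>, and there the correction
  \<open>of_bool (v = b)\<close> brings the coordinate to 0.\<close>

lemma continuous_on_edge_shift:
  assumes K: "geometric_complex N K" "\<forall>V\<in>K. card V \<le> 2" and ab: "{a, b} \<in> K" "a \<noteq> b"
  shows "continuous_on (open_star K v) (edge_shift a b v)"
proof -
  define T where "T = open_star K v"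
  let ?Q = "\<Union>W\<in>K - {{a, b}}. closed_simplex W"
  have fin: "finite K" using K by (simp add: geometric_complex_def)
  have cl: "closed (closed_simplex W)" if "W \<in> K" for W
    using compact_closed_simplex[of W] complex_simplex[OF K(1) that] K(2) that
    by (auto intro: compact_imp_closed)
  have Q: "closed ?Q" using fin cl by (intro closed_UN) auto
  \<comment> \<open>Another closed simplex containing a point of the open edge would have both end
    points among its at most two vertices.\<close>
  have QE: "x \<notin> open_simplex {a, b}" if x: "x \<in> ?Q" for x
  proof
    assume o: "x \<in> open_simplex {a, b}"
    obtain W where W: "W \<in> K" "W \<noteq> {a, b}" "x \<in> closed_simplex W" using x by auto
    have "{a, b} \<subseteq> W" using complex_carrier_minimal[OF K(1) ab(1) W(1) o W(3)] .
    moreover have "card W \<le> card {a, b}" using K(2) W(1) ab(2) by (simp add: numeral_2_eq_2)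
    ultimately show False using W(2) card_seteq complex_simplex(1)[OF K(1) W(1)] by metis
  qed
  have "T \<subseteq> closed_simplex {a, b} \<union> ?Q"
  proof
    fix x assume "x \<in> T"
    then obtain V where "V \<in> K" "x \<in> open_simplex V" by (auto simp: T_def open_star_def)
    then show "x \<in> closed_simplex {a, b} \<union> ?Q"
      using open_simplex_subset_closed[of V] by (cases "V = {a, b}") auto
  qed
  then have T: "T \<inter> closed_simplex {a, b} \<union> T \<inter> ?Q = T" by blast
  have eq: "segment_coord a b x - of_bool (v = b) = 0"
    if x: "x \<in> open_star K v" "x \<in> closed_simplex {a, b}" "x \<notin> open_simplex {a, b}" for x
  proof -
    obtain V where V: "V \<in> K" "v \<in> V" "x \<in> open_simplex V" using x(1) by (auto simp: open_star_def)
    obtain t where t: "t \<in> {0..1}" "x = segment_point a b t"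
      using x(2) by (auto simp: closed_simplex_pair[OF ab(2)])
    then have "t = 0 \<or> t = 1" using segment_point_outside_open_simplex[OF ab(2)] x(3) by blast
    then have xt: "x = a \<and> t = 0 \<or> x = b \<and> t = 1" using t by auto
    then have "{x} \<in> K" using complex_face[OF K(1) ab(1), of "{x}"] by auto
    then have "V = {x}" using complex_open_simplex_unique[OF K(1) V(1) _ V(3)] by simp
    then have "v = x" using V(2) by simp
    then show ?thesis using xt ab(2) segment_coord_point[OF ab(2), of t] t(2) by auto
  qed
  have "continuous_on (T \<inter> closed_simplex {a, b} \<union> T \<inter> ?Q)
    (\<lambda>x. if x \<in> closed_simplex {a, b} then segment_coord a b x - of_bool (v = b) else 0)"
  proof (rule continuous_on_cases_local)
    show "closedin (top_of_set (T \<inter> closed_simplex {a, b} \<union> T \<inter> ?Q)) (T \<inter> closed_simplex {a, b})"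
      unfolding T by (rule closedin_closed_Int[OF cl[OF ab(1)]])
    show "closedin (top_of_set (T \<inter> closed_simplex {a, b} \<union> T \<inter> ?Q)) (T \<inter> ?Q)"
      unfolding T by (rule closedin_closed_Int[OF Q])
    show "continuous_on (T \<inter> closed_simplex {a, b}) (\<lambda>x. segment_coord a b x - of_bool (v = b))"
      by (intro continuous_intros continuous_on_segment_coord)
    show "continuous_on (T \<inter> ?Q) (\<lambda>x. 0 :: real)" by simp
    fix x assume "x \<in> T \<inter> closed_simplex {a, b} \<and> x \<notin> closed_simplex {a, b} \<or>
      x \<in> T \<inter> ?Q \<and> x \<in> closed_simplex {a, b}"
    then have "x \<in> open_star K v" "x \<in> closed_simplex {a, b}" "x \<in> ?Q" by (auto simp: T_def)
    then show "segment_coord a b x - of_bool (v = b) = 0" using eq QE by blast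
  qed
  then have "continuous_on T
    (\<lambda>x. if x \<in> closed_simplex {a, b} then segment_coord a b x - of_bool (v = b) else 0)"
    unfolding T .
  then show ?thesis
    unfolding T_def[symmetric]
  proof (rule continuous_on_eq)
    fix x assume "x \<in> T"
    then have "x \<in> open_star K v" by (simp add: T_def)
    then show "(if x \<in> closed_simplex {a, b} then segment_coord a b x - of_bool (v = b) else 0)
        = edge_shift a b v x"
      using eq[of x] open_simplex_subset_closed[of "{a, b}"] by (auto simp: edge_shift_def)
  qed
qed

text \<open>Affine functions commute with combinations of total weight 1. In
  \<open>consecutive_edge\<close> this compares the parameter of a point with those of the vertices
  around it.\<close>

lemma segment_coord_lin_comb:
  assumes "sum c W = 1"
  shows "segment_coord a b (lin_comb c W) = (\<Sum>w\<in>W. c w * segment_coord a b w)"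
proof -
  define i where "i = (SOME i. a i \<noteq> b i)"
  have "(\<Sum>w\<in>W. c w * w i) - a i = (\<Sum>w\<in>W. c w * w i) - sum c W * a i" using assms by simp
  also have "\<dots> = (\<Sum>w\<in>W. c w * (w i - a i))"
    by (simp add: sum_distrib_right sum_subtractf right_diff_distrib)
  finally show ?thesis
    by (simp add: segment_coord_def lin_comb_def Let_def i_def[symmetric] sum_divide_distrib)
qed

lemma Ints_between: "r \<in> \<int> \<Longrightarrow> -1 < r \<Longrightarrow> r < 1 \<Longrightarrow> r = (0 :: real)"
  by (auto elim!: Ints_cases)

section \<open>Simplicial approximation on a graph\<close>

locale graph_approximation =
  fixes N :: nat and K K' :: "point set set" and g \<phi> :: "point \<Rightarrow> point"
  assumes complex: "geometric_complex N K"
    and card_simplex: "\<forall>V\<in>K. card V \<le> 2"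
    and subdiv: "subdivision N K' K"
    and approx: "simplicial_approximation K' K g \<phi>"
    and continuous: "continuous_on (polyhedron K) \<phi>"
begin

lemma complex': "geometric_complex N K'"
  using subdiv by (simp add: subdivision_def)

lemma subdivision_cover:
  assumes "V \<in> K" "x \<in> closed_simplex V"
  obtains W where "W \<in> K'" "closed_simplex W \<subseteq> closed_simplex V" "x \<in> closed_simplex W"
proof -
  obtain L where "L \<subseteq> K'" "closed_simplex V = (\<Union>W\<in>L. closed_simplex W)"
    using subdiv assms(1) unfolding subdivision_def by blast
  then show ?thesis using assms(2) that by blast
qed

text \<open>Some simplex of \<open>K'\<close> lies in \<open>{v}\<close>, and \<open>v\<close> is
  then its only vertex.\<close>

lemma subdivision_vertex:
  assumes "v \<in> \<Union>K" shows "{v} \<in> K'"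
proof -
  have "{v} \<in> K" using complex_vertex[OF complex assms] .
  then obtain W where W: "W \<in> K'" "closed_simplex W \<subseteq> {v}"
    using subdivision_cover[of "{v}" v] by auto
  moreover obtain w where "w \<in> W" using complex_simplex(2)[OF complex' W(1)] by blast
  moreover from this have "w = v"
    using vertex_in_closed_simplex[of W w] complex_simplex(1)[OF complex' W(1)] W(2) by blast
  ultimately show ?thesis using complex_face[OF complex' W(1), of "{v}"] by auto
qed

lemma approx_star:
  assumes "W \<in> K'" "w \<in> W" "x \<in> open_simplex W" shows "\<phi> x \<in> open_star K (g w)"
proof -
  have "x \<in> open_star K' w" using assms by (auto simp: open_star_def)
  then show ?thesis using approx assms(1,2) unfolding simplicial_approximation_def by blast
qed

text \<open>Subdivision sends the vertex \<open>v\<close> to itself, so only \<open>T = {v}\<close>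
  contributes. The trace in dimension 0 thus counts vertices fixed by \<open>g\<close>.\<close>

lemma M_entry_vertex:
  assumes "orientation K ori" "orientation K' ori'" "{v} \<in> K"
  shows "M_entry K' ori' ori g 0 {v} {v} = of_bool (g v = v)"
proof -
  have single: "l = [w]" if "distinct l" "set l = {w}" for l :: "point list" and w
  proof -
    have "length l = Suc 0" using distinct_card[OF that(1)] that(2) by simp
    then obtain u where "l = [u]" by (auto simp: length_Suc_conv)
    then show ?thesis using that(2) by simp
  qed
  have "ori {v} = [v]" using assms(1,3) single by (simp add: orientation_def)
  moreover have "ori' {w} = [w]" if "{w} \<in> K'" for w
    using assms(2) that single by (simp add: orientation_def)
  ultimately have coeff: "simplicial_coeff g (ori {v}) (ori' T) * subdivision_coeff (ori' T) (ori {v})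
      = (if T = {v} then of_bool (g v = v) else 0)" if "T \<in> K'" "card T = 0 + 1" for T
    using that complex_simplex(3)[OF complex assms(3)]
    by (auto simp: card_1_singleton_iff simplicial_coeff_singleton subdivision_coeff_singleton)
  have "{v} \<in> K'" using assms(3) by (intro subdivision_vertex) auto
  moreover have "finite K'" using complex' by (simp add: geometric_complex_def)
  ultimately show ?thesis unfolding M_entry_def
    by (subst sum.cong[OF refl coeff]) (auto simp: sum.delta)
qed

end

section \<open>The subdivision of one edge and its diagonal entry\<close>

locale fixed_point_free_edge = graph_approximation +
  fixes a b :: point
  assumes edge: "{a, b} \<in> K" "a \<noteq> b"
    and no_fixed_point: "\<And>x. x \<in> open_simplex {a, b} \<Longrightarrow> \<phi> x \<noteq> x"
begin

abbreviation pt :: "real \<Rightarrow> point" where "pt \<equiv> segment_point a b"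

definition breaks :: "real set" where
  "breaks = {t \<in> {0..1}. pt t \<in> \<Union>K'}"

lemma endpoints_in_breaks: "0 \<in> breaks" "1 \<in> breaks"
proof -
  have "{a} \<in> K'" "{b} \<in> K'" using edge(1) by (blast intro: subdivision_vertex)+
  then show "0 \<in> breaks" "1 \<in> breaks" by (auto simp: breaks_def)
qed

lemma finite_breaks: "finite breaks"
proof -
  have "finite (\<Union>K')"
    using complex' complex_simplex(1)[OF complex'] by (auto simp: geometric_complex_def)
  moreover have "breaks \<subseteq> segment_coord a b ` \<Union>K'"
  proof
    fix t assume "t \<in> breaks"
    then show "t \<in> segment_coord a b ` \<Union>K'"
      using segment_coord_point[OF edge(2), of t] unfolding breaks_def
      by (metis (no_types, lifting) imageI mem_Collect_eq)
  qed
  ultimately show ?thesis by (metis finite_surj)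
qed

lemma breaks_subset: "t \<in> breaks \<Longrightarrow> 0 \<le> t \<and> t \<le> 1"
  by (simp add: breaks_def)

lemma Min_breaks: "Min breaks = 0"
  by (rule Min_eqI[OF finite_breaks]) (use breaks_subset endpoints_in_breaks in blast)+

lemma Max_breaks: "Max breaks = 1"
  by (rule Max_eqI[OF finite_breaks]) (use breaks_subset endpoints_in_breaks in blast)+

lemma consecutive_breaksD:
  assumes "(x, y) \<in> consecutive breaks"
  shows "x \<in> breaks" "y \<in> breaks" "x < y" "0 \<le> x" "y \<le> 1" "\<And>z. z \<in> breaks \<Longrightarrow> z \<le> x \<or> y \<le> z"
proof -
  have xy: "x \<in> breaks \<and> y \<in> breaks \<and> x < y \<and> (\<forall>z\<in>breaks. \<not> (x < z \<and> z < y))"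
    using assms unfolding consecutive_def by blast
  then show "x \<in> breaks" "y \<in> breaks" "x < y" "0 \<le> x" "y \<le> 1"
    using breaks_subset by blast+
  show "z \<le> x \<or> y \<le> z" if "z \<in> breaks" for z
    using xy that by (meson not_le)
qed

lemma vertex_param:
  assumes "W \<in> K'" "closed_simplex W \<subseteq> closed_simplex {a, b}" "w \<in> W"
  obtains t where "t \<in> breaks" "w = pt t"
proof -
  have "w \<in> closed_simplex {a, b}"
    using vertex_in_closed_simplex[OF complex_simplex(1)[OF complex' assms(1)] assms(3)] assms(2) by blast
  then obtain t where "t \<in> {0..1}" "w = pt t" by (auto simp: closed_simplex_pair[OF edge(2)])
  then show ?thesis using that[of t] assms(1,3) unfolding breaks_def by blast
qed

text \<open>The midpoint lies in a simplex \<open>W\<close> of \<open>K'\<close> inside the edge,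
  and its parameter is a weighted mean of those of the vertices of \<open>W\<close>. So
  \<open>W\<close> has a vertex \<open>u\<close> at or before \<open>x\<close> and a vertex
  \<open>v\<close> at or after \<open>y\<close>. The edge \<open>{u, v}\<close> contains
  \<open>pt x\<close> and \<open>pt y\<close>; being vertices of \<open>K'\<close>, they are its end
  points.\<close>

lemma consecutive_edge:
  assumes xy: "(x, y) \<in> consecutive breaks" shows "{pt x, pt y} \<in> K'"
proof -
  note D = consecutive_breaksD[OF xy]
  define s where "s = segment_coord a b"
  define m where "m = (x + y) / 2"
  have m: "x < m" "m < y" using D(3) by (auto simp: m_def)
  have "pt m \<in> closed_simplex {a, b}" using m D by (auto simp: closed_simplex_pair[OF edge(2)])
  then obtain W where W: "W \<in> K'" "closed_simplex W \<subseteq> closed_simplex {a, b}" "pt m \<in> closed_simplex W"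
    using subdivision_cover[OF edge(1)] by blast
  then obtain c where c: "\<forall>w\<in>W. 0 \<le> c w" "sum c W = 1" "pt m = lin_comb c W"
    by (auto simp: closed_simplex_def)
  have W_pt: "w = pt (s w)" "s w \<in> breaks" if "w \<in> W" for w
    using vertex_param[OF W(1,2) that] edge(2) unfolding s_def by (metis segment_coord_point)+
  have "m = (\<Sum>w\<in>W. c w * s w)"
    using segment_coord_lin_comb[OF c(2), of a b] segment_coord_point[OF edge(2), of m]
    by (simp add: c(3) s_def)
  moreover have "(\<Sum>w\<in>W. c w * y) \<le> (\<Sum>w\<in>W. c w * s w)" if "\<forall>w\<in>W. y \<le> s w"
    using that c(1) by (intro sum_mono mult_left_mono) auto
  moreover have "(\<Sum>w\<in>W. c w * s w) \<le> (\<Sum>w\<in>W. c w * x)" if "\<forall>w\<in>W. s w \<le> x"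
    using that c(1) by (intro sum_mono mult_left_mono) auto
  ultimately obtain u v where uv: "u \<in> W" "v \<in> W" "s u \<le> x" "y \<le> s v"
    using m c(2) D(6) W_pt(2) by (metis leD sum_distrib_right mult_1)
  have uvK: "{u, v} \<in> K'" using complex_face[OF complex' W(1)] uv by simp
  have "closed_simplex {u, v} = pt ` {s u..s v}"
    using closed_simplex_segment[OF edge(2), of "s u" "s v"] W_pt(1) uv D(3) by auto
  then have "pt x \<in> {u, v}" "pt y \<in> {u, v}"
    using uv D by (intro complex_vertex_in_simplex[OF complex' _ uvK]; auto simp: breaks_def)+
  moreover have "pt x \<noteq> v" "pt y \<noteq> u"
    using uv(3,4) D(3) segment_coord_point[OF edge(2)] unfolding s_def by force+
  ultimately have "pt x = u" "pt y = v" by blast+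
  then show ?thesis using uvK by simp
qed

text \<open>One direction is \<open>consecutive_edge\<close>. Conversely, a break strictly between
  the end points of an edge of \<open>K'\<close> would be a vertex of \<open>K'\<close> in that
  closed edge without being one of its end points.\<close>

lemma bij_betw_consecutive_edges:
  "bij_betw (\<lambda>(x, y). {pt x, pt y}) (consecutive breaks)
     {T \<in> K'. card T = 2 \<and> closed_simplex T \<subseteq> closed_simplex {a, b}}"
  unfolding bij_betw_def
proof (intro conjI equalityI subsetI)
  show "inj_on (\<lambda>(x, y). {pt x, pt y}) (consecutive breaks)"
    by (auto simp: inj_on_def doubleton_eq_iff segment_point_eq_iff[OF edge(2)] consecutive_def)
next
  fix T assume "T \<in> (\<lambda>(x, y). {pt x, pt y}) ` consecutive breaks"
  then obtain x y where xy: "(x, y) \<in> consecutive breaks" "T = {pt x, pt y}" by auto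
  note D = consecutive_breaksD[OF xy(1)]
  have "closed_simplex T \<subseteq> closed_simplex {a, b}"
    using D by (auto simp: xy(2) closed_simplex_segment[OF edge(2)] closed_simplex_pair[OF edge(2)])
  then show "T \<in> {T \<in> K'. card T = 2 \<and> closed_simplex T \<subseteq> closed_simplex {a, b}}"
    using consecutive_edge[OF xy(1)] D(3) xy(2) by (auto simp: segment_point_eq_iff[OF edge(2)])
next
  fix T assume "T \<in> {T \<in> K'. card T = 2 \<and> closed_simplex T \<subseteq> closed_simplex {a, b}}"
  then have T: "T \<in> K'" "card T = 2" "closed_simplex T \<subseteq> closed_simplex {a, b}" by auto
  obtain u v where uv: "T = {u, v}" "u \<noteq> v" using T(2) by (auto simp: card_2_iff)
  obtain p q where pq: "p \<in> breaks" "u = pt p" "q \<in> breaks" "v = pt q"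
    using vertex_param[OF T(1,3)] uv(1) by (metis insertI1 insertI2)
  define x y where "x = min p q" and "y = max p q"
  have "p \<noteq> q" using uv(2) pq by auto
  then have xy: "x \<in> breaks" "y \<in> breaks" "x < y" "T = {pt x, pt y}"
    using pq uv by (auto simp: x_def y_def min_def max_def)
  have "\<not> (x < z \<and> z < y)" if "z \<in> breaks" for z
  proof
    assume z: "x < z \<and> z < y"
    then have "pt z \<in> closed_simplex T"
      by (auto simp: xy(4) closed_simplex_segment[OF edge(2) xy(3)])
    moreover have "pt z \<in> \<Union>K'" using that by (simp add: breaks_def)
    ultimately have "pt z \<in> T" using complex_vertex_in_simplex[OF complex' _ T(1)] by blast
    then show False using z xy(4) by (auto simp: segment_point_eq_iff[OF edge(2)])
  qed
  then have "(x, y) \<in> consecutive breaks" using xy by (auto simp: consecutive_def)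
  then show "T \<in> (\<lambda>(x, y). {pt x, pt y}) ` consecutive breaks" using xy(4) by force
qed

text \<open>The signed number of times that the simplicial image of the segment from
  \<open>pt x\<close> to \<open>pt y\<close> runs through the edge from \<open>a\<close> to
  \<open>b\<close>.\<close>

definition crossing :: "real \<Rightarrow> real \<Rightarrow> int" where
  "crossing x y = of_bool (g (pt x) = a \<and> g (pt y) = b) - of_bool (g (pt x) = b \<and> g (pt y) = a)"

text \<open>Reversing the orientation of a subdivision edge changes the sign of both coefficients,
  so each product depends only on the direction from \<open>a\<close> to \<open>b\<close>.\<close>

lemma M_entry_edge:
  assumes "orientation K' ori'" "ori {a, b} = [a, b]"
  shows "M_entry K' ori' ori g 1 {a, b} {a, b} = of_int (\<Sum>(x, y)\<in>consecutive breaks. crossing x y)"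
proof -
  let ?f = "\<lambda>T. simplicial_coeff g [a, b] (ori' T) * subdivision_coeff (ori' T) [a, b]"
  have ind: "affinely_independent {a, b}" using complex_simplex(3)[OF complex edge(1)] .
  have fin: "finite K'" using complex' by (simp add: geometric_complex_def)
  have ori': "distinct (ori' T)" "set (ori' T) = T" if "T \<in> K'" for T
    using assms(1) that by (auto simp: orientation_def)
  have "M_entry K' ori' ori g 1 {a, b} {a, b}
      = (\<Sum>T | T \<in> K' \<and> card T = 2. ?f T)"
    by (simp add: M_entry_def assms(2) numeral_2_eq_2)
  \<comment> \<open>\<open>subdivision_coeff\<close> vanishes on edges not contained in the edge
    \<open>ab\<close>.\<close>
  also have "\<dots> = (\<Sum>T\<in>{T \<in> K'. card T = 2 \<and> closed_simplex T \<subseteq> closed_simplex {a, b}}. ?f T)"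
    using fin ori' by (intro sum.mono_neutral_right) (auto simp: subdivision_coeff_def)
  also have "\<dots> = (\<Sum>p\<in>consecutive breaks. ?f ((\<lambda>(x, y). {pt x, pt y}) p))"
    by (rule sum.reindex_bij_betw[OF bij_betw_consecutive_edges, symmetric])
  also have "\<dots> = (\<Sum>(x, y)\<in>consecutive breaks. of_int (crossing x y))"
  proof (rule sum.cong[OF refl], clarify)
    fix x y assume xy: "(x, y) \<in> consecutive breaks"
    note D = consecutive_breaksD[OF xy]
    have "ori' {pt x, pt y} = [pt x, pt y] \<or> ori' {pt x, pt y} = [pt y, pt x]"
      using ori'[OF consecutive_edge[OF xy]] D(3)
      by (intro distinct_set_pair) (auto simp: segment_point_eq_iff[OF edge(2)])
    then show "?f {pt x, pt y} = of_int (crossing x y)"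
      using D edge(2) subdivision_coeff_pair[OF ind edge(2), of x y]
        subdivision_coeff_pair[OF ind edge(2), of y x]
      by (auto simp: simplicial_coeff_pair crossing_def)
  qed
  finally show ?thesis by (simp add: of_int_sum case_prod_beta)
qed

section \<open>Displacement along the edge\<close>

text \<open>Up to an integer depending only on the break \<open>s\<close>, this is the function \<open>F t - t\<close> near \<open>s\<close>.\<close>

definition disp :: "real \<Rightarrow> real \<Rightarrow> real" where
  "disp s t = edge_shift a b (g (pt s)) (\<phi> (pt t)) - t"

text \<open>If \<open>\<phi> (pt t) = pt u\<close> is in the open edge, an integral displacement
  makes \<open>u - t\<close> an integer strictly between -1 and 1, hence 0, and \<open>pt t\<close>
  is fixed. Otherwise the displacement is \<open>- t\<close>, which is not an integer.\<close>

lemma disp_not_Ints: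
  assumes t: "0 < t" "t < 1" shows "disp s t \<notin> \<int>"
proof
  assume int: "disp s t \<in> \<int>"
  show False
  proof (cases "\<phi> (pt t) \<in> open_simplex {a, b}")
    case True
    then obtain u where u: "0 < u" "u < 1" "\<phi> (pt t) = pt u"
      by (auto simp: open_simplex_pair[OF edge(2)])
    define e :: real where "e = of_bool (g (pt s) = b)"
    have "u - t = disp s t + e"
      using u by (simp add: disp_def edge_shift_segment_point[OF edge(2)] e_def)
    moreover have "e \<in> \<int>" by (simp add: e_def)
    ultimately have "u - t \<in> \<int>" using Ints_add[OF int, of e] by metis
    then have "u = t" using Ints_between[of "u - t"] u t by simp
    moreover have "pt t \<in> open_simplex {a, b}" using t by (auto simp: open_simplex_pair[OF edge(2)])
    ultimately show False using no_fixed_point u(3) by blast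
  next
    case False
    then have "- t \<in> \<int>" using int by (simp add: disp_def edge_shift_def)
    then show False using Ints_between[of "- t"] t by simp
  qed
qed

text \<open>A point of the open subdivision edge lies in the open stars of both end vertices, but an
  end vertex only in its own star; hence the two half-open intervals.\<close>

lemma star_near_break:
  assumes xy: "(x, y) \<in> consecutive breaks"
  shows "x \<le> t \<Longrightarrow> t < y \<Longrightarrow> \<phi> (pt t) \<in> open_star K (g (pt x))"
    and "x < t \<Longrightarrow> t \<le> y \<Longrightarrow> \<phi> (pt t) \<in> open_star K (g (pt y))"
proof -
  note D = consecutive_breaksD[OF xy]
  have inner: "\<phi> (pt t) \<in> open_star K (g (pt z))" if "x < t" "t < y" "z = x \<or> z = y" for z
    using that by (intro approx_star[OF consecutive_edge[OF xy]])
      (auto simp: open_simplex_segment[OF edge(2) D(3)])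
  have vertex: "\<phi> (pt z) \<in> open_star K (g (pt z))" if "z \<in> breaks" for z
    using complex_vertex[OF complex', of "pt z"] that
    by (intro approx_star[of "{pt z}"]) (auto simp: breaks_def)
  show "x \<le> t \<Longrightarrow> t < y \<Longrightarrow> \<phi> (pt t) \<in> open_star K (g (pt x))"
    using inner[of x] vertex[OF D(1)] by (cases "x = t") auto
  show "x < t \<Longrightarrow> t \<le> y \<Longrightarrow> \<phi> (pt t) \<in> open_star K (g (pt y))"
    using inner[of y] vertex[OF D(2)] by (cases "t = y") auto
qed

text \<open>Continuity of \<open>edge_shift\<close> for a given vertex holds on the open star of
  that vertex, hence the hypothesis that the images stay in one star.\<close>

lemma continuous_on_disp:
  assumes "I \<subseteq> {0..1}" "\<And>t. t \<in> I \<Longrightarrow> \<phi> (pt t) \<in> open_star K (g (pt s))"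
  shows "continuous_on I (disp s)"
proof -
  have "pt ` I \<subseteq> closed_simplex {a, b}"
    unfolding closed_simplex_pair[OF edge(2)] by (rule image_mono[OF assms(1)])
  then have "pt ` I \<subseteq> polyhedron K" using edge(1) unfolding polyhedron_def by blast
  then have "continuous_on I (\<lambda>t. \<phi> (pt t))"
    by (intro continuous_on_compose2[OF continuous continuous_on_segment_point])
  then have "continuous_on I (\<lambda>t. edge_shift a b (g (pt s)) (\<phi> (pt t)))"
    using assms(2)
    by (intro continuous_on_compose2[OF continuous_on_edge_shift[OF complex card_simplex edge]]) auto
  then show ?thesis unfolding disp_def by (intro continuous_intros)
qed

text \<open>A lower bound at the left end of a subdivision edge, and an upper bound at its right end, for the
  constant value on that edge of the floor of \<^term>\<open>disp s\<close>; for breaks \<open>s\<close> inside the edge \<open>ab\<close> both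
  bounds are sharp.\<close>

definition level :: "real \<Rightarrow> int" where
  "level s = (if s < 1 then \<lceil>disp s s\<rceil> - 1 else \<lfloor>disp s s\<rfloor>)"

text \<open>At an inner point of the subdivision edge the displacements measured from
  \<open>x\<close> and from \<open>y\<close> differ by exactly \<open>crossing x y\<close>. Neither
  takes an integer value inside the edge, so their floors there are compared with the levels at the
  two ends by the intermediate value theorem.\<close>

lemma level_diff_le_crossing:
  assumes xy: "(x, y) \<in> consecutive breaks"
  shows "level x - level y \<le> crossing x y"
proof -
  note D = consecutive_breaksD[OF xy]
  define m where "m = (x + y) / 2"
  have m: "x < m" "m < y" using D(3) by (auto simp: m_def)
  have "\<lceil>disp x x\<rceil> - 1 \<le> \<lfloor>disp x m\<rfloor>"
    using m D star_near_break(1)[OF xy]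
    by (intro ceiling_le_floor_of_no_integer_value continuous_on_disp disp_not_Ints) auto
  then have lx: "level x \<le> \<lfloor>disp x m\<rfloor>" using m D by (simp add: level_def)
  have "\<lfloor>disp y m\<rfloor> \<le> \<lfloor>disp y y\<rfloor>"
    using m D star_near_break(2)[OF xy]
    by (intro floor_le_floor_of_no_integer_value continuous_on_disp disp_not_Ints) auto
  \<comment> \<open>The break \<open>y\<close> is positive: either \<open>y < 1\<close> and the
    value is not an integer, or \<open>y = 1\<close> and this is the definition.\<close>
  moreover have "level y = \<lfloor>disp y y\<rfloor>"
    using ceiling_minus_1_eq_floor[OF disp_not_Ints, of y y] D by (auto simp: level_def)
  ultimately have ly: "\<lfloor>disp y m\<rfloor> \<le> level y" by simp
  obtain Q where Q: "Q \<in> K" "g (pt x) \<in> Q" "\<phi> (pt m) \<in> open_simplex Q"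
    using star_near_break(1)[OF xy, of m] m by (auto simp: open_star_def)
  obtain Q' where Q': "Q' \<in> K" "g (pt y) \<in> Q'" "\<phi> (pt m) \<in> open_simplex Q'"
    using star_near_break(2)[OF xy, of m] m by (auto simp: open_star_def)
  \<comment> \<open>So the simplex carrying \<open>\<phi> (pt m)\<close> has both
    \<open>g (pt x)\<close> and \<open>g (pt y)\<close> as vertices.\<close>
  have "Q' = Q" using complex_open_simplex_unique[OF complex Q'(1) Q(1) Q'(3) Q(3)] .
  have "disp x m = disp y m + of_int (crossing x y)"
  proof (cases "Q = {a, b}")
    case True
    then have "g (pt x) \<in> {a, b}" "g (pt y) \<in> {a, b}" using Q Q' \<open>Q' = Q\<close> by auto
    then show ?thesis using True Q(3) edge(2)
      by (auto simp: disp_def edge_shift_def crossing_def)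
  next
    case False
    then have "\<phi> (pt m) \<notin> open_simplex {a, b}"
      using complex_open_simplex_unique[OF complex Q(1) edge(1) Q(3)] by blast
    \<comment> \<open>A nonzero crossing would put both \<open>a\<close> and \<open>b\<close> into
      \<open>Q\<close>, which has at most two vertices.\<close>
    moreover have "crossing x y = 0"
    proof (rule ccontr)
      assume "crossing x y \<noteq> 0"
      then have "{a, b} = {g (pt x), g (pt y)}" by (auto simp: crossing_def split: if_splits)
      then have "{a, b} \<subseteq> Q" using Q(2) Q'(2) \<open>Q' = Q\<close> by simp
      moreover have "card Q \<le> card {a, b}"
        using card_simplex Q(1) edge(2) by (simp add: numeral_2_eq_2)
      ultimately show False using False card_seteq complex_simplex(1)[OF complex Q(1)] by metis
    qed
    ultimately show ?thesis by (simp add: disp_def edge_shift_def)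
  qed
  then have "\<lfloor>disp x m\<rfloor> = \<lfloor>disp y m\<rfloor> + crossing x y" by simp
  then show ?thesis using lx ly by linarith
qed

text \<open>The differences of levels telescope to \<open>level 0 - level 1\<close>, which is
  \<open>\<lceil>e a\<rceil> - \<lfloor>e b\<rfloor>\<close> with shifts \<open>e\<close> strictly
  between -1 and 1. Both terms contribute at least 0; \<open>P a\<close> makes \<open>e a\<close>
  positive and \<open>P b\<close> makes \<open>e b\<close> negative, and each then contributes
  1.\<close>

lemma M_entry_edge_ge:
  assumes "orientation K' ori'" "ori {a, b} = [a, b]"
  shows "of_nat (card {v \<in> {a, b}. g v = v \<and> \<phi> v \<in> open_simplex {a, b}})
    \<le> M_entry K' ori' ori g 1 {a, b} {a, b}"
proof -
  define P where "P v \<longleftrightarrow> g v = v \<and> \<phi> v \<in> open_simplex {a, b}" for v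
  define e where "e v = edge_shift a b (g v) (\<phi> v)" for v
  have e: "-1 < e v" "e v < 1" "P v \<Longrightarrow> v \<noteq> b \<Longrightarrow> 0 < e v" "P v \<Longrightarrow> v = b \<Longrightarrow> e v < 0" for v
  proof -
    have "\<phi> v \<in> open_simplex {a, b} \<Longrightarrow>
        0 < segment_coord a b (\<phi> v) \<and> segment_coord a b (\<phi> v) < 1"
      using edge(2) by (auto simp: open_simplex_pair)
    then show "-1 < e v" "e v < 1" "P v \<Longrightarrow> v \<noteq> b \<Longrightarrow> 0 < e v" "P v \<Longrightarrow> v = b \<Longrightarrow> e v < 0"
      by (auto simp: e_def P_def edge_shift_def)
  qed
  have "{v \<in> {a, b}. P v} = (if P a then {a} else {}) \<union> (if P b then {b} else {})" by auto
  then have "int (card {v \<in> {a, b}. P v}) = of_bool (P a) + of_bool (P b)" using edge(2) by simp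
  also have "\<dots> \<le> level 0 - level 1"
  proof -
    have a: "0 \<le> \<lceil>e a\<rceil>" "P a \<Longrightarrow> 1 \<le> \<lceil>e a\<rceil>" using e(1,3)[of a] edge(2) by simp_all
    have b: "\<lfloor>e b\<rfloor> \<le> 0" "P b \<Longrightarrow> \<lfloor>e b\<rfloor> < 0" using e(2,4)[of b] by simp_all
    have "of_bool (P a) \<le> \<lceil>e a\<rceil>" using a by (cases "P a") auto
    moreover have "of_bool (P b) \<le> - \<lfloor>e b\<rfloor>"
    proof (cases "P b")
      case True
      with b(2) have "\<lfloor>e b\<rfloor> < 0" .
      then have "1 \<le> - \<lfloor>e b\<rfloor>" by linarith
      with True show ?thesis by (simp only: of_bool_eq)
    next
      case False
      moreover have "0 \<le> - \<lfloor>e b\<rfloor>" using b(1) by linarith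
      ultimately show ?thesis by (simp only: of_bool_eq)
    qed
    \<comment> \<open>The first \<open>- 1\<close> comes from the definition of
      \<open>level\<close>, the second from \<open>disp 1 1 = e b - 1\<close>.\<close>
    moreover have "level 0 = \<lceil>e a\<rceil> - 1" "level 1 = \<lfloor>e b\<rfloor> - 1"
      by (simp_all add: level_def disp_def e_def)
    ultimately show ?thesis by linarith
  qed
  also have "\<dots> = (\<Sum>(x, y)\<in>consecutive breaks. level x - level y)"
  proof -
    have "breaks \<noteq> {}" using endpoints_in_breaks by blast
    from sum_consecutive[OF finite_breaks this, of level] show ?thesis
      by (simp only: Min_breaks Max_breaks)
  qed
  also have "\<dots> \<le> (\<Sum>(x, y)\<in>consecutive breaks. crossing x y)"
    by (intro sum_mono) (auto intro: level_diff_le_crossing)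
  finally have "int (card {v \<in> {a, b}. P v}) \<le> (\<Sum>(x, y)\<in>consecutive breaks. crossing x y)" .
  then have "of_int (int (card {v \<in> {a, b}. P v}))
      \<le> (of_int (\<Sum>(x, y)\<in>consecutive breaks. crossing x y) :: rat)"
    by (simp only: of_int_le_iff)
  then show ?thesis
    by (simp only: M_entry_edge[of ori' ori, OF assms] P_def of_int_of_nat_eq)
qed

end

section \<open>The sum over a graph\<close>

context graph_approximation
begin

text \<open>Naming the end points in the order given by \<open>ori\<close> provides the assumption
  \<open>ori {a, b} = [a, b]\<close> of the edge estimate; the count of end points does not depend
  on the order.\<close>

lemma M_entry_ge_card_fixed_vertices:
  assumes ori: "orientation K ori" "orientation K' ori'"
    and V: "V \<in> K" "card V = 2" "\<And>x. x \<in> open_simplex V \<Longrightarrow> \<phi> x \<noteq> x"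
  shows "of_nat (card {v \<in> V. g v = v \<and> \<phi> v \<in> open_simplex V}) \<le> M_entry K' ori' ori g 1 V V"
proof -
  have o: "distinct (ori V)" "set (ori V) = V" using ori(1) V(1) by (auto simp: orientation_def)
  have "length (ori V) = 2" using distinct_card[OF o(1)] o(2) V(2) by simp
  then obtain a b where ab: "ori V = [a, b]" by (auto simp: numeral_2_eq_2 length_Suc_conv)
  then have V_eq: "V = {a, b}" "a \<noteq> b" using o by auto
  interpret fixed_point_free_edge N K K' g \<phi> a b
    using V V_eq by unfold_locales auto
  show ?thesis using M_entry_edge_ge[of ori' ori, OF ori(2)] ab by (simp add: V_eq(1))
qed

lemma lefschetz_sum_eq:
  "lefschetz_sum K K' ori ori' g A =
     (\<Sum>V | V \<in> K \<and> card V = 1 \<and> open_simplex V \<subseteq> A. M_entry K' ori' ori g 0 V V) -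
     (\<Sum>V | V \<in> K \<and> card V = 2 \<and> open_simplex V \<subseteq> A. M_entry K' ori' ori g 1 V V)"
proof -
  define S where
    "S p = (\<Sum>V | V \<in> K \<and> card V = p + 1 \<and> open_simplex V \<subseteq> A. M_entry K' ori' ori g p V V)" for p
  have fin: "finite (\<Union>K)"
    using complex complex_simplex(1)[OF complex] by (auto simp: geometric_complex_def)
  have big: "S p = 0" if p: "2 \<le> p \<or> card (\<Union>K) \<le> p" for p
  proof -
    have "card V \<noteq> p + 1" if "V \<in> K" for V
    proof -
      have "card V \<le> 2" "card V \<le> card (\<Union>K)"
        using card_simplex that fin by (auto intro: card_mono)
      then show ?thesis using p by linarith
    qed
    then have "{V \<in> K. card V = p + 1 \<and> open_simplex V \<subseteq> A} = {}" by blast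
    then show ?thesis unfolding S_def by (simp only: sum.empty)
  qed
  have "lefschetz_sum K K' ori ori' g A = (\<Sum>p<card (\<Union>K). (-1) ^ p * S p)"
    by (simp add: lefschetz_sum_def S_def)
  \<comment> \<open>\<open>card (\<Union>K)\<close> can be less than 2, so the range is enlarged to
    contain 0 and 1 before the terms from 2 on are dropped.\<close>
  also have "\<dots> = (\<Sum>p<max 2 (card (\<Union>K)). (-1) ^ p * S p)"
    by (rule sum.mono_neutral_left) (auto simp: big)
  also have "\<dots> = (\<Sum>p<2. (-1) ^ p * S p)"
    by (rule sum.mono_neutral_right) (auto simp: big)
  also have "\<dots> = S 0 - S 1" by (simp add: numeral_2_eq_2)
  finally show ?thesis by (simp add: S_def numeral_2_eq_2)
qed

text \<open>Each vertex \<open>v\<close> of \<open>A\<close> fixed by \<open>g\<close> is charged to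
  the edge whose interior contains \<open>\<phi> v\<close>; edge by edge, the number of charges is
  at most the diagonal entry.\<close>

lemma lefschetz_sum_nonpos:
  assumes ori: "orientation K ori" "orientation K' ori'"
    and C: "C \<subseteq> K" "A = (\<Union>V\<in>C. open_simplex V)"
    and A: "\<phi> ` A \<subseteq> A" "\<And>x. x \<in> A \<Longrightarrow> \<phi> x \<noteq> x"
  shows "lefschetz_sum K K' ori ori' g A \<le> 0"
proof -
  define Vs where "Vs = {v. {v} \<in> K \<and> v \<in> A}"
  define E where "E = {V. V \<in> K \<and> card V = 2 \<and> open_simplex V \<subseteq> A}"
  define F where "F V = {v \<in> V. g v = v \<and> \<phi> v \<in> open_simplex V}" for V
  have finK: "finite K" using complex by (simp add: geometric_complex_def)
  then have finE: "finite E" by (simp add: E_def)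
  have finV: "finite Vs"
    by (rule finite_imageD[of "\<lambda>v. {v}"], rule finite_subset[OF _ finK]) (auto simp: Vs_def)
  have "{V. V \<in> K \<and> card V = 1 \<and> open_simplex V \<subseteq> A} = (\<lambda>v. {v}) ` Vs"
    by (auto simp: Vs_def card_1_singleton_iff)
  then have "(\<Sum>V | V \<in> K \<and> card V = 1 \<and> open_simplex V \<subseteq> A. M_entry K' ori' ori g 0 V V)
      = (\<Sum>v\<in>Vs. M_entry K' ori' ori g 0 {v} {v})"
    by (simp add: sum.reindex)
  also have "\<dots> = (\<Sum>v\<in>Vs. of_bool (g v = v))"
    by (rule sum.cong[OF refl M_entry_vertex[OF ori]]) (simp add: Vs_def)
  also have "\<dots> = of_nat (card {v \<in> Vs. g v = v})"
    using finV by (simp add: Int_def)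
  also have "\<dots> \<le> of_nat (\<Sum>V\<in>E. card (F V))"
  proof -
    have "{v \<in> Vs. g v = v} \<subseteq> (\<Union>V\<in>E. F V)"
    proof
      fix v assume "v \<in> {v \<in> Vs. g v = v}"
      then have v: "{v} \<in> K" "v \<in> A" "g v = v" by (auto simp: Vs_def)
      have "{v} \<in> K'" using v(1) by (blast intro: subdivision_vertex)
      \<comment> \<open>As \<open>g v = v\<close>, the star condition makes \<open>v\<close> a
        vertex of the simplex whose interior contains \<open>\<phi> v\<close>; as
        \<open>\<phi> v \<noteq> v\<close>, that simplex is an edge.\<close>
      then have "\<phi> v \<in> open_star K v" using approx_star[of "{v}" v v] v(3) by simp
      then obtain V where V: "V \<in> K" "v \<in> V" "\<phi> v \<in> open_simplex V"
        by (auto simp: open_star_def)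
      have "V \<noteq> {v}" using V(3) A(2)[OF v(2)] by auto
      then have "card V = 2"
        using V(2) card_le_2_cases[OF complex_simplex(1,2)[OF complex V(1)]] card_simplex V(1)
        by (metis card_2_iff singletonD)
      \<comment> \<open>Distinct open simplices of \<open>K\<close> are disjoint and
        \<open>A\<close> is a union of some of them, so one that meets \<open>A\<close> lies in
        \<open>A\<close>.\<close>
      moreover have "open_simplex V \<subseteq> A"
      proof -
        have "\<phi> v \<in> A" using A(1) v(2) by blast
        then obtain W where "W \<in> C" "\<phi> v \<in> open_simplex W" using C(2) by auto
        then show ?thesis
          using complex_open_simplex_unique[OF complex V(1) _ V(3)] C by blast
      qed
      ultimately have "V \<in> E" "v \<in> F V" using V v(3) by (auto simp: E_def F_def)
      then show "v \<in> (\<Union>V\<in>E. F V)" by blast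
    qed
    moreover have "finite (\<Union>V\<in>E. F V)"
      using finE complex_simplex(1)[OF complex] by (auto simp: E_def F_def)
    ultimately have "card {v \<in> Vs. g v = v} \<le> card (\<Union>V\<in>E. F V)" by (intro card_mono)
    also have "\<dots> \<le> (\<Sum>V\<in>E. card (F V))" by (rule card_UN_le[OF finE])
    finally show ?thesis by (rule of_nat_mono)
  qed
  also have "\<dots> \<le> (\<Sum>V\<in>E. M_entry K' ori' ori g 1 V V)"
    unfolding of_nat_sum F_def
    by (intro sum_mono M_entry_ge_card_fixed_vertices[OF ori] A(2)) (auto simp: E_def)
  finally show ?thesis by (simp add: lefschetz_sum_eq E_def)
qed

end

section \<open>Dimension\<close>

text \<open>The coordinates of the barycentre are perturbed at three vertices in proportion to
  \<open>Re z\<close>, \<open>Im z\<close> and \<open>- (Re z + Im z)\<close>. Their sum stays 1,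
  and affine independence gives injectivity.\<close>

lemma open_simplex_contains_disc:
  assumes V: "affinely_independent V" "3 \<le> card V"
  obtains h :: "complex \<Rightarrow> point"
  where "continuous_on (ball 0 1) h" "inj_on h (ball 0 1)" "h ` ball 0 1 \<subseteq> open_simplex V"
proof -
  have fin: "finite V" using V(1) by (simp add: affinely_independent_def)
  obtain T where "T \<subseteq> V" "card T = 3" using obtain_subset_with_card_n[OF V(2)] by blast
  then obtain a b c where abc: "a \<in> V" "b \<in> V" "c \<in> V" "a \<noteq> b" "a \<noteq> c" "b \<noteq> c"
    by (auto simp: card_3_iff)
  define n where "n = real (card V)"
  have n: "0 < n" using V(2) by (simp add: n_def)
  define w where "w z v = of_bool (v = a) * Re z + of_bool (v = b) * Im z - of_bool (v = c) * (Re z + Im z)"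
    for z :: complex and v :: point
  \<comment> \<open>On the unit disc \<open>w\<close> stays below 2 in absolute value, so the factor
    1/4 keeps the coefficients positive.\<close>
  define k where "k z v = (1 + w z v / 4) / n" for z v
  define h where "h z = lin_comb (k z) V" for z
  have delta: "(\<Sum>v\<in>V. of_bool (v = u) * r) = r" if "u \<in> V" for u and r :: real
  proof -
    have "V \<inter> {v. v = u} = {u}" using that by auto
    then show ?thesis using fin by simp
  qed
  have "sum (w z) V = 0" for z
    unfolding w_def using abc by (simp only: sum_subtractf sum.distrib delta)
  then have sum: "sum (k z) V = 1" for z
    using n by (simp add: k_def sum_divide_distrib[symmetric] sum.distrib n_def[symmetric])
  have pos: "0 < k z v" if z: "z \<in> ball 0 1" for z v
  proof -
    have "\<bar>Re z\<bar> < 1" "\<bar>Im z\<bar> < 1"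
      using z abs_Re_le_cmod[of z] abs_Im_le_cmod[of z] by auto
    then have "\<bar>w z v\<bar> < 2" using abc by (auto simp: w_def of_bool_def)
    then show ?thesis using n by (simp add: k_def)
  qed
  have "continuous_on (ball 0 1) h"
    unfolding h_def lin_comb_def k_def w_def
    by (intro continuous_on_coordinatewise_then_product continuous_intros) (use n in auto)
  moreover have "inj_on h (ball 0 1)"
  proof (rule inj_onI)
    fix z z' assume "h z = h z'"
    then have "k z v = k z' v" if "v \<in> V" for v
      using affinely_independent_unique[OF V(1), of "k z" "k z'" v] sum that by (simp add: h_def)
    then have "w z v = w z' v" if "v \<in> V" for v using that n by (simp add: k_def)
    from this[of a] this[of b] show "z = z'" using abc by (simp add: w_def complex_eq_iff)
  qed
  moreover have "h ` ball 0 1 \<subseteq> open_simplex V"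
    using sum pos by (auto simp: h_def open_simplex_def)
  ultimately show ?thesis using that by blast
qed

text \<open>Some point of the disc avoids the finitely many vertices and lands in an open edge.
  Nearby points land in the same open edge, so a nonempty open subset of the plane embeds in the
  line, against invariance of dimension.\<close>

lemma graph_contains_no_disc:
  fixes h :: "complex \<Rightarrow> point"
  assumes L: "geometric_complex N L" and C: "C \<subseteq> L" "\<forall>V\<in>C. card V \<le> 2"
    and h: "continuous_on (ball 0 1) h" "inj_on h (ball 0 1)"
      "h ` ball 0 1 \<subseteq> (\<Union>V\<in>C. open_simplex V)"
  shows False
proof -
  have "finite L" using L by (simp add: geometric_complex_def)
  then have finC: "finite C" using C(1) finite_subset by blast
  have "finite {v. {v} \<in> C}"
    by (rule finite_imageD[of "\<lambda>v. {v}"], rule finite_subset[OF _ finC]) auto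
  moreover have "infinite (h ` ball 0 1)"
  proof -
    have "uncountable (ball (0 :: complex) 1)" by (rule uncountable_ball) simp
    then have "infinite (ball (0 :: complex) 1)" using countable_finite by blast
    then show ?thesis using finite_image_iff[OF h(2)] by blast
  qed
  ultimately obtain z where z: "z \<in> ball 0 1" "{h z} \<notin> C"
    using finite_subset[of "h ` ball 0 1" "{v. {v} \<in> C}"] by blast
  obtain E where E: "E \<in> C" "h z \<in> open_simplex E" using h(3) z(1) by blast
  have EL: "E \<in> L" using E(1) C(1) by blast
  have "\<not> (\<exists>v. E = {v})" using E z(2) by auto
  then obtain a b where ab: "a \<noteq> b" "E = {a, b}"
    using card_le_2_cases[OF complex_simplex(1,2)[OF L EL]] C(2) E(1) by metis
  \<comment> \<open>\<open>Q\<close> is closed and misses \<open>h z\<close>, because a closed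
    simplex of the graph that contains a point of the open edge \<open>E\<close> is \<open>E\<close>
    itself. So the preimage of its complement is an open neighbourhood of \<open>z\<close> mapped
    into that open edge.\<close>
  define Q where "Q = (\<Union>W\<in>C - {E}. closed_simplex W)"
  have cl: "closed (closed_simplex W)" if "W \<in> C" for W
    using compact_closed_simplex[OF complex_simplex(1,2)[OF L]] C that
    by (auto intro: compact_imp_closed)
  have "closed Q" unfolding Q_def using finC cl by (intro closed_UN) auto
  define B where "B = ball 0 1 \<inter> h -` (- Q)"
  have "open B" unfolding B_def
    using continuous_open_preimage[OF h(1) open_ball] \<open>closed Q\<close> by (simp add: open_Compl)
  moreover have "h z \<notin> Q"
  proof
    assume "h z \<in> Q"
    then obtain W where W: "W \<in> C" "W \<noteq> E" "h z \<in> closed_simplex W" by (auto simp: Q_def)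
    then have WL: "W \<in> L" using C(1) by blast
    have "E \<subseteq> W" using complex_carrier_minimal[OF L EL WL E(2) W(3)] .
    moreover have "card W \<le> card E" using C(2) W(1) ab by (simp add: numeral_2_eq_2)
    ultimately show False using W(2) card_seteq complex_simplex(1)[OF L WL] by metis
  qed
  then have "z \<in> B" using z(1) by (simp add: B_def)
  moreover have hB: "h x \<in> open_simplex {a, b}" if "x \<in> B" for x
  proof -
    have x: "x \<in> ball 0 1" "h x \<notin> Q" using that by (auto simp: B_def)
    then obtain W where "W \<in> C" "h x \<in> open_simplex W" using h(3) by blast
    then show ?thesis using x(2) ab(2) open_simplex_subset_closed[of W] by (auto simp: Q_def)
  qed
  have "continuous_on B (segment_coord a b \<circ> h)"
    by (intro continuous_on_compose continuous_on_segment_coord continuous_on_subset[OF h(1)])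
       (simp add: B_def)
  moreover have "inj_on (segment_coord a b \<circ> h) B"
  proof (rule comp_inj_on)
    show "inj_on h B" using h(2) by (rule inj_on_subset) (simp add: B_def)
    have "inj_on (segment_coord a b) (open_simplex {a, b})"
      using ab(1) by (auto simp: inj_on_def open_simplex_pair)
    then show "inj_on (segment_coord a b) (h ` B)" by (rule inj_on_subset) (use hB in auto)
  qed
  ultimately have "DIM(complex) \<le> DIM(real)"
    by (intro invariance_of_dimension[of B "segment_coord a b \<circ> h"]) auto
  then show False by simp
qed

text \<open>A simplex of \<open>C\<close> with three or more vertices would contain a disc, which
  \<open>e\<close> would embed in a graph. The closed simplices of \<open>C\<close> form a compact
  set whose image is closed and contains a dense part of \<open>X\<close>, hence covers
  \<open>X\<close>; so every simplex of \<open>K\<close> is a face of one in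
  \<open>C\<close>.\<close>

lemma card_simplex_le_2_of_dense_graph:
  fixes e \<tau> \<tau>' :: "point \<Rightarrow> point"
  assumes K: "geometric_complex N K" "C \<subseteq> K" and L: "geometric_complex M L" "D \<subseteq> L" "\<forall>V\<in>D. card V \<le> 2"
    and e: "continuous_on (\<Union>V\<in>C. open_simplex V) e" "inj_on e (\<Union>V\<in>C. open_simplex V)"
      "e ` (\<Union>V\<in>C. open_simplex V) \<subseteq> (\<Union>V\<in>D. open_simplex V)"
    and X: "homeomorphism (polyhedron K) X \<tau> \<tau>'" "X \<subseteq> closure (\<tau> ` (\<Union>V\<in>C. open_simplex V))"
  shows "\<forall>V\<in>K. card V \<le> 2"
proof
  let ?A = "\<Union>V\<in>C. open_simplex V"
  have finC: "finite C" using K by (auto simp: geometric_complex_def intro: finite_subset)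
  have C2: "card V \<le> 2" if "V \<in> C" for V
  proof (rule ccontr)
    assume "\<not> card V \<le> 2"
    then have "3 \<le> card V" by simp
    moreover have "affinely_independent V" using complex_simplex(3)[OF K(1)] K(2) that by blast
    ultimately obtain h :: "complex \<Rightarrow> point" where h: "continuous_on (ball 0 1) h"
      "inj_on h (ball 0 1)" "h ` ball 0 1 \<subseteq> open_simplex V"
      using open_simplex_contains_disc by blast
    then have A: "h ` ball 0 1 \<subseteq> ?A" using that by blast
    show False
    proof (rule graph_contains_no_disc[OF L, of "e \<circ> h"])
      show "continuous_on (ball 0 1) (e \<circ> h)"
        using h(1) continuous_on_subset[OF e(1) A] by (rule continuous_on_compose)
      show "inj_on (e \<circ> h) (ball 0 1)"
        using h(2) inj_on_subset[OF e(2) A] by (rule comp_inj_on)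
      show "(e \<circ> h) ` ball 0 1 \<subseteq> (\<Union>V\<in>D. open_simplex V)"
        unfolding image_comp[symmetric] using image_mono[OF A] e(3) by (rule subset_trans)
    qed
  qed
  define Q where "Q = (\<Union>W\<in>C. closed_simplex W)"
  have QK: "Q \<subseteq> polyhedron K" using K(2) by (auto simp: Q_def polyhedron_def)
  have "compact Q" unfolding Q_def
    using finC C2 K(2) complex_simplex(1,2)[OF K(1)]
    by (intro compact_UN) (auto intro!: compact_closed_simplex)
  moreover have "continuous_on Q \<tau>"
    using X(1) QK continuous_on_subset unfolding homeomorphism_def by metis
  ultimately have "compact (\<tau> ` Q)" using compact_continuous_image by blast
  then have "closed (\<tau> ` Q)" by (rule compact_imp_closed)
  moreover have "?A \<subseteq> Q" unfolding Q_def using open_simplex_subset_closed by fast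
  ultimately have "closure (\<tau> ` ?A) \<subseteq> \<tau> ` Q" by (intro closure_minimal image_mono)
  then have XQ: "X \<subseteq> \<tau> ` Q" using X(2) by blast
  fix V assume V: "V \<in> K"
  obtain x where x: "x \<in> open_simplex V"
    using open_simplex_nonempty complex_simplex(1,2)[OF K(1) V] by metis
  then have xK: "x \<in> polyhedron K" using V open_simplex_subset_closed[of V] by (auto simp: polyhedron_def)
  then have "\<tau> x \<in> X" using X(1) by (auto simp: homeomorphism_def)
  then obtain y where "y \<in> Q" "\<tau> x = \<tau> y" using XQ by blast
  then have "x \<in> Q" using X(1) xK QK unfolding homeomorphism_def by (metis subsetD)
  then obtain W where W: "W \<in> C" "x \<in> closed_simplex W" by (auto simp: Q_def)
  then have WK: "W \<in> K" using K(2) by blast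
  have "V \<subseteq> W" using complex_carrier_minimal[OF K(1) V WK x W(2)] .
  then show "card V \<le> 2"
    using C2[OF W(1)] card_mono[OF complex_simplex(1)[OF K(1) WK]] by (meson order_trans)
qed

section \<open>The fixed point theorem\<close>

theorem theorem5p15:
  fixes S :: "nat \<Rightarrow> point set set" and n :: nat and U :: "point set"
    and f :: "point \<Rightarrow> point" and q :: rat
  assumes "o_minimal_structure S"
    and "\<forall>k. semilinear_sets k \<subseteq> S k"
    and "U \<in> S n"
    and "closedin (Euclidean_space n) U"
    and "connected U"
    and "definable_dimension S n U 1"
    and "\<exists>g. homeomorphism U U f g"
    and "has_Lambda_comb S n f U q"
    and "q \<ge> 1"
  shows "\<exists>x\<in>U. f x = x"
proof (rule ccontr)
  assume no_fix: "\<not> (\<exists>x\<in>U. f x = x)"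
  obtain M L D \<sigma> \<sigma>' where L: "geometric_complex M L" "D \<subseteq> L" "\<forall>V\<in>D. card V \<le> 2"
    and \<sigma>: "homeomorphism (\<Union>V\<in>D. open_simplex V) U \<sigma> \<sigma>'"
    using assms(6) unfolding definable_dimension_def definable_homeomorphism_def
    by (metis one_add_one)
  obtain m X j f' where fU: "continuous_map (top_of_set U) (top_of_set U) f"
    and X: "definable_compactification S n U m X j"
    and f': "continuous_map (top_of_set X) (top_of_set X) f'" "\<forall>x\<in>U. f' (j x) = j (f x)"
    and \<Lambda>: "has_Lambda S m X (j ` U) f' q"
    using assms(8) unfolding has_Lambda_comb_def by blast
  obtain j' where j: "homeomorphism U (j ` U) j j'" and dense: "X \<subseteq> closure (j ` U)"
    and jX: "j ` U \<subseteq> X"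
    using X unfolding definable_compactification_def definable_homeomorphism_def by blast
  obtain N K \<tau> \<tau>' A K' g ori ori' C where K: "geometric_complex N K"
    and \<tau>: "homeomorphism (polyhedron K) X \<tau> \<tau>'"
    and A: "A = {x \<in> polyhedron K. \<tau> x \<in> j ` U}"
    and C: "C \<subseteq> K" "A = (\<Union>V\<in>C. open_simplex V)"
    and sub: "subdivision N K' K" "simplicial_approximation K' K g (\<tau>' \<circ> f' \<circ> \<tau>)"
    and ori: "orientation K ori" "orientation K' ori'"
    and q: "q = lefschetz_sum K K' ori ori' g A"
    using \<Lambda> unfolding has_Lambda_def definable_homeomorphism_def by blast
  note hom = homeomorphism_def
  have f'X: "continuous_on X f'" "f' ` X \<subseteq> X" using f'(1) by auto
  have fU_U: "f x \<in> U" if "x \<in> U" for x using fU that by auto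
  have \<tau>': "\<tau>' y \<in> polyhedron K" "\<tau> (\<tau>' y) = y" if "y \<in> X" for y
    using homeomorphism_image2[OF \<tau>] homeomorphism_apply2[OF \<tau>] that by blast+
  have \<tau>A: "\<tau> ` A = j ` U"
  proof
    show "j ` U \<subseteq> \<tau> ` A"
    proof
      fix y assume y: "y \<in> j ` U"
      then have "\<tau>' y \<in> polyhedron K" "\<tau> (\<tau>' y) = y" using \<tau>' jX by blast+
      then have "\<tau>' y \<in> A" using y by (simp add: A)
      then show "y \<in> \<tau> ` A" using \<open>\<tau> (\<tau>' y) = y\<close> by (metis imageI)
    qed
    show "\<tau> ` A \<subseteq> j ` U" unfolding A by blast
  qed
  define \<phi> where "\<phi> = \<tau>' \<circ> f' \<circ> \<tau>"
  \<comment> \<open>\<open>e\<close> embeds \<open>A\<close> in the graph that triangulates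
    \<open>U\<close>; together with the density of \<open>U\<close> in \<open>X\<close> this bounds
    the dimension of all of \<open>K\<close>.\<close>
  define e where "e = \<sigma>' \<circ> j' \<circ> \<tau>"
  have AK: "A \<subseteq> polyhedron K" unfolding A by blast
  have "\<forall>V\<in>K. card V \<le> 2"
  proof (rule card_simplex_le_2_of_dense_graph[OF K C(1) L, of e X \<tau> \<tau>'])
    have hA: "homeomorphism A (j ` U) \<tau> \<tau>'"
      using homeomorphism_of_subsets[OF \<tau> AK _ \<tau>A] jX by auto
    have "homeomorphism A (\<Union>V\<in>D. open_simplex V) e (\<tau>' \<circ> (j \<circ> \<sigma>))"
      using homeomorphism_compose[OF homeomorphism_compose[OF hA homeomorphism_symD[OF j]]
          homeomorphism_symD[OF \<sigma>]]
      by (simp only: e_def comp_assoc)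
    then show "continuous_on (\<Union>V\<in>C. open_simplex V) e" "inj_on e (\<Union>V\<in>C. open_simplex V)"
      "e ` (\<Union>V\<in>C. open_simplex V) \<subseteq> (\<Union>V\<in>D. open_simplex V)"
      unfolding hom C(2)[symmetric] by (auto intro: inj_on_inverseI)
    show "X \<subseteq> closure (\<tau> ` (\<Union>V\<in>C. open_simplex V))"
      using dense unfolding C(2)[symmetric] \<tau>A .
  qed (rule \<tau>)
  moreover have "continuous_on (polyhedron K) \<phi>"
    unfolding \<phi>_def
  proof (intro continuous_on_compose)
    have X_eq: "\<tau> ` polyhedron K = X" using \<tau> by (simp add: hom)
    show "continuous_on (polyhedron K) \<tau>" using \<tau> by (simp add: hom)
    show "continuous_on (\<tau> ` polyhedron K) f'" using f'X(1) X_eq by simp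
    show "continuous_on (f' ` \<tau> ` polyhedron K) \<tau>'"
      using \<tau> f'X(2) X_eq continuous_on_subset unfolding hom by metis
  qed
  ultimately interpret graph_approximation N K K' g \<phi>
    using K sub by unfold_locales (auto simp: \<phi>_def)
  \<comment> \<open>On \<open>A\<close> the map \<open>\<phi>\<close> is conjugate to
    \<open>f\<close> on \<open>U\<close> through \<open>\<tau>\<close> and \<open>j\<close>, so it
    preserves \<open>A\<close>, and a fixed point in \<open>A\<close> would give one of
    \<open>f\<close>.\<close>
  have step: "\<phi> x \<in> A \<and> \<phi> x \<noteq> x" if x: "x \<in> A" for x
  proof -
    obtain u where u: "u \<in> U" "\<tau> x = j u" using x unfolding A by blast
    have "j (f u) \<in> X" using fU_U[OF u(1)] jX by blast
    then have "\<tau>' (j (f u)) \<in> polyhedron K" "\<tau> (\<tau>' (j (f u))) = j (f u)"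
      by (rule \<tau>')+
    moreover have "\<phi> x = \<tau>' (j (f u))" using f'(2) u by (simp add: \<phi>_def)
    ultimately have \<phi>x: "\<phi> x \<in> polyhedron K" "\<tau> (\<phi> x) = j (f u)" by auto
    have "j (f u) \<noteq> j u"
      using no_fix u(1) fU_U[OF u(1)] homeomorphism_apply1[OF j] by metis
    then have "\<phi> x \<noteq> x" using \<phi>x(2) u(2) by auto
    moreover have "\<phi> x \<in> A" using \<phi>x fU_U[OF u(1)] by (simp add: A)
    ultimately show ?thesis by blast
  qed
  have "q \<le> 0"
    unfolding q using step by (intro lefschetz_sum_nonpos[OF ori C]) auto
  then show False using assms(9) by simp
qed

end
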